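(* Let $\mathbb{K}$ be an algebraically closed field of characteristic $0$, let $q\in\mathbb{K}$ be nonzero and not a root of unity, and let $V$ be a vector space over $\mathbb{K}$ with finite positive dimension. Let $A,A^*$ be a tridiagonal pair on $V$ which satisfies the $q$-Serre relations $$A^3A^*-[3]A^2A^*A+[3]AA^*A^2-A^*A^3=0,$$ $$A^{*3}A-[3]A^{*2}AA^*+[3]A^*AA^{*2}-AA^{*3}=0,$$ where $[3]=(q^3-q^{-3})/(q-q^{-1})$. Let $d$ denote the diameter and $(\rho_0,\rho_1,\ldots,\rho_d)$ the shape vector of $A,A^*$. Then $$\rho_i\le\binom{d}{i}\qquad(0\le i\le d).$$
   Context: A linear transformation $V\to V$ is diagonalizable if $V$ is spanned by its eigenspaces. Tridiagonal pair: an ordered pair $A,A^*$ of linear transformations $V\to V$ (here $A^*$ is just a name; it is not the conjugate-transpose of $A$) such that (i) each of $A,A^*$ is diagonalizable; (ii) there is an ordering $V_0,V_1,\ldots,V_d$ of the eigenspaces of $A$ with $A^*V_i\subseteq V_{i-1}+V_i+V_{i+1}$ for $0\le i\le d$, where $V_{-1}=V_{d+1}=0$; (iii) there is an ordering $V^*_0,V^*_1,\ldots,V^*_\delta$ of the eigenspaces of $A^*$ with $AV^*_i\subseteq V^*_{i-1}+V^*_i+V^*_{i+1}$ for $0\le i\le\delta$, where $V^*_{-1}=V^*_{\delta+1}=0$; (iv) there is no subspace $W$ of $V$ with $AW\subseteq W$, $A^*W\subseteq W$, $W\ne0$, $W\ne V$. It is known that $d=\delta$; this common value is called the diameter. Orderings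 of the eigenspaces as in (ii), (iii) are called standard. It is known that for standard orderings $V_0,\ldots,V_d$ and $V_0^*,\ldots,V_d^*$ one has $\dim V_i=\dim V^*_i$ for $0\le i\le d$; this common dimension is denoted $\rho_i$, it does not depend on the choice of standard orderings, and $(\rho_0,\ldots,\rho_d)$ is called the shape vector of $A,A^*$. The relations in the claim are the expanded form of $[A,\,A^2A^*-\beta AA^*A+A^*A^2]=0$ and $[A^*,\,A^{*2}A-\beta A^*AA^*+AA^{*2}]=0$ with $\beta=q^2+q^{-2}$ and $[r,s]=rs-sr$. *)

theory Defs
  imports "HOL-Computational_Algebra.Computational_Algebra"
begin

text \<open>
  The vector space is the whole type \<open>'v\<close> with scalar multiplication \<open>scale\<close>; linear
  transformations are functions \<open>'v \<Rightarrow> 'v\<close>.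
\<close>

definition eigenspaces :: "('k::field \<Rightarrow> 'v::ab_group_add \<Rightarrow> 'v) \<Rightarrow> ('v \<Rightarrow> 'v) \<Rightarrow> 'v set set" where
  "eigenspaces scale A = {E. E \<noteq> {0} \<and> (\<exists>c. E = {v. A v = scale c v})}"

definition diagonalizable :: "('k::field \<Rightarrow> 'v::ab_group_add \<Rightarrow> 'v) \<Rightarrow> ('v \<Rightarrow> 'v) \<Rightarrow> bool" where
  "diagonalizable scale A \<longleftrightarrow> module.span scale (\<Union>(eigenspaces scale A)) = UNIV"

text \<open>The family \<open>V 0, \<dots>, V d\<close> extended by the zero subspace; indices are integers so that
  \<open>V\<^sub>-\<^sub>1\<close> makes sense.\<close>

definition zero_extend :: "nat \<Rightarrow> (nat \<Rightarrow> 'v::zero set) \<Rightarrow> int \<Rightarrow> 'v set" where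
  "zero_extend d V j = (if 0 \<le> j \<and> j \<le> int d then V (nat j) else {0})"

definition standard_ordering ::
  "('k::field \<Rightarrow> 'v::ab_group_add \<Rightarrow> 'v) \<Rightarrow> ('v \<Rightarrow> 'v) \<Rightarrow> ('v \<Rightarrow> 'v) \<Rightarrow> nat \<Rightarrow> (nat \<Rightarrow> 'v set) \<Rightarrow> bool" where
  "standard_ordering scale A B d V \<longleftrightarrow>
     bij_betw V {0..d} (eigenspaces scale A) \<and>
     (\<forall>i\<in>{0..d}. B ` V i \<subseteq>
        {x + y + z | x y z. x \<in> zero_extend d V (int i - 1) \<and> y \<in> zero_extend d V (int i) \<and>
                            z \<in> zero_extend d V (int i + 1)})"

definition tridiagonal_pair ::
  "('k::field \<Rightarrow> 'v::ab_group_add \<Rightarrow> 'v) \<Rightarrow> ('v \<Rightarrow> 'v) \<Rightarrow> ('v \<Rightarrow> 'v) \<Rightarrow> bool" where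
  "tridiagonal_pair scale A B \<longleftrightarrow>
     Vector_Spaces.linear scale scale A \<and> Vector_Spaces.linear scale scale B \<and>
     diagonalizable scale A \<and> diagonalizable scale B \<and>
     (\<exists>d V. standard_ordering scale A B d V) \<and>
     (\<exists>\<delta> V'. standard_ordering scale B A \<delta> V') \<and>
     \<not> (\<exists>W. module.subspace scale W \<and> A ` W \<subseteq> W \<and> B ` W \<subseteq> W \<and> W \<noteq> {0} \<and> W \<noteq> UNIV)"

text \<open>
  \<open>d\<close> is the diameter and \<open>(\<rho> 0, \<dots>, \<rho> d)\<close> the shape vector of the pair. For a tridiagonal pair,
  standard orderings of the eigenspaces of \<open>A\<close> and of \<open>B\<close> have the same length and the same
  dimensions, so all choices below agree. The definition does not build in this fact: the data
  may be read off from any standard ordering of the eigenspaces of either map. Values \<open>\<rho> i\<close> with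
  \<open>i > d\<close> are irrelevant.
\<close>

definition diameter_and_shape ::
  "('k::field \<Rightarrow> 'v::ab_group_add \<Rightarrow> 'v) \<Rightarrow> ('v \<Rightarrow> 'v) \<Rightarrow> ('v \<Rightarrow> 'v) \<Rightarrow> nat \<Rightarrow> (nat \<Rightarrow> nat) \<Rightarrow> bool" where
  "diameter_and_shape scale A B d \<rho> \<longleftrightarrow>
     (\<exists>V. (standard_ordering scale A B d V \<or> standard_ordering scale B A d V) \<and>
          (\<forall>i\<in>{0..d}. \<rho> i = vector_space.dim scale (V i)))"

definition q_bracket :: "'k::field \<Rightarrow> nat \<Rightarrow> 'k" where
  "q_bracket q n = (q ^ n - inverse q ^ n) / (q - inverse q)"

definition q_serre ::
  "('k::field \<Rightarrow> 'v::ab_group_add \<Rightarrow> 'v) \<Rightarrow> 'k \<Rightarrow> ('v \<Rightarrow> 'v) \<Rightarrow> ('v \<Rightarrow> 'v) \<Rightarrow> bool" where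
  "q_serre scale q A B \<longleftrightarrow>
     (\<forall>v. (A ^^ 3) (B v) - scale (q_bracket q 3) ((A ^^ 2) (B (A v)))
          + scale (q_bracket q 3) (A (B ((A ^^ 2) v))) - B ((A ^^ 3) v) = 0)"

end

theory Submission
  imports Defs "HOL-Library.Function_Algebras"
begin

text \<open>
  Write \<open>Q = q\<^sup>2\<close>. The Serre relation, applied to an eigenvector of \<open>A\<close>, forces consecutive eigenvalues
  of \<open>A\<close> in a standard ordering to have ratio \<open>Q\<close> or \<open>1 / Q\<close>, the same ratio all along the ordering;
  likewise for \<open>A'\<close>. Replacing \<open>q\<close> by its inverse and reversing an ordering if necessary, the
  eigenvalues are \<open>\<theta>\<^sub>i = \<alpha> Q\<^sup>i\<close> on \<open>V\<^sub>i\<close> for \<open>A\<close> and \<open>\<theta>'\<^sub>i = \<beta> / Q\<^sup>i\<close> on \<open>V'\<^sub>i\<close> for \<open>A'\<close>. Let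
  \<open>F\<^sub>i = V\<^sub>i + \<dots> + V\<^sub>d\<close>, \<open>G\<^sub>i = V'\<^sub>0 + \<dots> + V'\<^sub>i\<close> and \<open>U\<^sub>i = G\<^sub>i \<inter> F\<^sub>i\<close>. Then \<open>A - \<theta>\<^sub>i\<close> maps \<open>U\<^sub>i\<close> to the next
  component and \<open>A' - \<theta>'\<^sub>i\<close> maps it to the previous one; call these maps \<open>R\<close> (raising) and \<open>L\<close>
  (lowering). Because the two eigenvalue sequences run in opposite directions, all lower order terms
  cancel and \<open>R\<close>, \<open>L\<close> satisfy the Serre relations again.

  The source of everything else is the higher Serre relation: for a pair \<open>X\<close>, \<open>Y\<close> satisfying the Serre
  relation, \<open>X\<^sup>a Y\<^sup>n X\<^sup>N\<^sup>-\<^sup>a\<close> depends on \<open>a\<close> as a combination of the \<open>2 n + 1\<close> geometric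
  sequences \<open>Q\<^sup>j\<^sup>a\<close>, \<open>-n \<le> j \<le> n\<close>, so it is determined by its values at any \<open>2 n + 1\<close> positions
  (\<open>q_serre_power\<close>, \<open>q_serre_interpolation\<close>). This has two consequences. The operators
  \<open>L\<^sup>k R\<^sup>k\<close> on \<open>U\<^sub>0\<close> commute (\<open>raise_lower_commute\<close>), hence, the field being algebraically closed, they
  have a common eigenvector \<open>v\<close>. And every word in \<open>R\<close> and \<open>L\<close> applied to \<open>v\<close> is a combination of
  words \<open>\<dots> R\<^sup>k\<^sup>3 L\<^sup>k\<^sup>2 R\<^sup>k\<^sup>1 v\<close> with \<open>d \<ge> k1 > k2 > k3 > \<dots> \<ge> 1\<close> (\<open>alt_word_straighten\<close>).

  The span of these words is invariant under \<open>A\<close> and \<open>A'\<close>, so it is the whole space. A word lies in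
  \<open>U\<^sub>i\<close> where \<open>i = k1 - k2 + k3 - \<dots>\<close>, and exactly \<open>d choose i\<close> subsets of \<open>{1..d}\<close> have alternating sum
  \<open>i\<close>. Irreducibility also gives \<open>G\<^sub>i\<^sub>-\<^sub>1 \<inter> F\<^sub>i = 0\<close>, so \<open>F\<^sub>i\<close> is spanned by the words in \<open>U\<^sub>i\<close> together
  with \<open>F\<^sub>i\<^sub>+\<^sub>1\<close>; as \<open>V\<^sub>i\<close> meets \<open>F\<^sub>i\<^sub>+\<^sub>1\<close> only in \<open>0\<close>, its dimension is at most the number of these words.
\<close>

section \<open>Interpolation weights\<close>

text \<open>
  Evaluation at \<open>z\<close> of polynomials of degree less than \<open>card P\<close> is a combination of the evaluations at
  the nodes \<open>y p\<close> (Lagrange interpolation, tested on monomials). To add a node \<open>y p0\<close>, use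
  \<open>f z = f (y p0) + (z - y p0) * g z\<close> where the difference quotient \<open>g\<close> has degree one less.
\<close>

lemma interpolation_weights:
  fixes y :: "'i \<Rightarrow> 'k::field"
  assumes "finite P" "inj_on y P"
  shows "\<exists>l. \<forall>k<card P. (\<Sum>p\<in>P. l p * y p ^ k) = z ^ k"
  using assms
proof (induction P)
  case (insert p0 P)
  then obtain l where l: "\<And>k. k < card P \<Longrightarrow> (\<Sum>p\<in>P. l p * y p ^ k) = z ^ k" by auto
  define l' where "l' = (\<lambda>p. l p * (z - y p0) / (y p - y p0))"
  define m where "m = l'(p0 := 1 - (\<Sum>p\<in>P. l' p))"
  have "(\<Sum>p\<in>insert p0 P. m p * y p ^ k) = z ^ k" if "k < card (insert p0 P)" for k
  proof -
    have "(\<Sum>p\<in>insert p0 P. m p * y p ^ k) = m p0 * y p0 ^ k + (\<Sum>p\<in>P. m p * y p ^ k)"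
      using insert.hyps by simp
    also have "(\<Sum>p\<in>P. m p * y p ^ k) = (\<Sum>p\<in>P. l' p * y p ^ k)"
      using insert.hyps by (intro sum.cong) (auto simp: m_def)
    also have "m p0 * y p0 ^ k + (\<Sum>p\<in>P. l' p * y p ^ k)
        = y p0 ^ k + (\<Sum>p\<in>P. l' p * (y p ^ k - y p0 ^ k))"
      by (simp add: m_def algebra_simps sum_subtractf sum_distrib_left sum_distrib_right)
    also have "(\<Sum>p\<in>P. l' p * (y p ^ k - y p0 ^ k))
        = (\<Sum>p\<in>P. l p * (z - y p0) * (\<Sum>i<k. y p ^ i * y p0 ^ (k - Suc i)))"
    proof (intro sum.cong refl)
      fix p assume "p \<in> P"
      then have ne: "y p - y p0 \<noteq> 0"
        using insert.hyps insert.prems by (auto simp: inj_on_def)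
      show "l' p * (y p ^ k - y p0 ^ k) = l p * (z - y p0) * (\<Sum>i<k. y p ^ i * y p0 ^ (k - Suc i))"
        using ne by (simp add: l'_def power_diff_sumr2 mult_ac)
    qed
    also have "\<dots> = (z - y p0) * (\<Sum>i<k. (\<Sum>p\<in>P. l p * y p ^ i) * y p0 ^ (k - Suc i))"
      unfolding sum_distrib_left sum_distrib_right
      by (subst sum.swap) (simp add: mult_ac)
    also have "(\<Sum>i<k. (\<Sum>p\<in>P. l p * y p ^ i) * y p0 ^ (k - Suc i))
        = (\<Sum>i<k. z ^ i * y p0 ^ (k - Suc i))"
      using that insert.hyps by (intro sum.cong refl) (simp add: l)
    also have "y p0 ^ k + (z - y p0) * (\<Sum>i<k. z ^ i * y p0 ^ (k - Suc i)) = z ^ k"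
    proof -
      have "(z - y p0) * (\<Sum>i<k. z ^ i * y p0 ^ (k - Suc i)) = z ^ k - y p0 ^ k"
        by (simp add: power_diff_sumr2 mult_ac)
      then show ?thesis by simp
    qed
    finally show ?thesis .
  qed
  then show ?case by blast
qed simp

section \<open>The higher Serre relations\<close>

locale q_vector_space = vector_space scale
  for scale :: "'a::field \<Rightarrow> 'b::ab_group_add \<Rightarrow> 'b" +
  fixes q :: 'a
  assumes q_nonzero: "q \<noteq> 0" and q_not_root_of_unity: "n > 0 \<Longrightarrow> q ^ n \<noteq> 1"
begin

abbreviation lin :: "('b \<Rightarrow> 'b) \<Rightarrow> bool" where
  "lin T \<equiv> Vector_Spaces.linear scale scale T"

lemma linD:
  fixes T :: "'b \<Rightarrow> 'b"
  assumes "lin T"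
  shows "T (x + y) = T x + T y" "T (x - y) = T x - T y" "T (scale c x) = scale c (T x)" "T 0 = 0" 
  "T (- x) = - T x" "T (sum f I) = (\<Sum>i\<in>I. T (f i))"
proof -
  interpret T: Vector_Spaces.linear scale scale T by fact
  show "T (x + y) = T x + T y" "T (x - y) = T x - T y" "T (scale c x) = scale c (T x)" "T 0 = 0"
  "T (- x) = - T x" "T (sum f I) = (\<Sum>i\<in>I. T (f i))"
    by (simp_all add: T.add T.diff T.scale T.zero T.neg T.sum)
qed

lemma linI:
  fixes T :: "'b \<Rightarrow> 'b"
  assumes "\<And>x y. T (x + y) = T x + T y" "\<And>c x. T (scale c x) = scale c (T x)"
  shows "lin T"
    unfolding Vector_Spaces.linear_iff using assms vector_space_axioms by blast

lemma lin_comp: "lin S \<Longrightarrow> lin T \<Longrightarrow> lin (\<lambda>x. S (T x))"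
  by (rule linI) (simp_all add: linD)

lemma lin_funpow: "lin T \<Longrightarrow> lin (T ^^ n)"
  by (induction n) (auto intro!: linI simp: linD)

lemma span_invariant:
  assumes "lin T" "T ` S \<subseteq> span S"
  shows "T ` span S \<subseteq> span S"
proof -
  have "subspace {x. T x \<in> span S}"
    using linD[OF assms(1)] by (auto simp: subspace_def span_zero span_add span_scale)
  then have "span S \<subseteq> {x. T x \<in> span S}" using assms(2) by (intro span_minimal) auto
  then show ?thesis by auto
qed

text \<open>
  The Serre relation for \<open>X\<close>, \<open>Y\<close> says that \<open>Y\<close> is killed by three successive \<open>q\<close>-commutators with \<open>X\<close>,
  with parameters \<open>1 / Q\<close>, \<open>1\<close>, \<open>Q\<close>. The iterated version below multiplies the parameter by \<open>Q\<close> from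
  one commutator to the next.
\<close>

definition qcomm :: "'a \<Rightarrow> ('b \<Rightarrow> 'b) \<Rightarrow> ('b \<Rightarrow> 'b) \<Rightarrow> 'b \<Rightarrow> 'b" where
  "qcomm c X T = (\<lambda>v. X (T v) - scale c (T (X v)))"

primrec qcomm_iter :: "'a \<Rightarrow> ('b \<Rightarrow> 'b) \<Rightarrow> nat \<Rightarrow> 'a \<Rightarrow> ('b \<Rightarrow> 'b) \<Rightarrow> 'b \<Rightarrow> 'b" where
  "qcomm_iter Q X 0 c T = T"
| "qcomm_iter Q X (Suc m) c T = qcomm_iter Q X m (c * Q) (qcomm c X T)"

lemma lin_qcomm: "lin X \<Longrightarrow> lin T \<Longrightarrow> lin (qcomm c X T)"
  unfolding qcomm_def by (rule linI) (simp_all add: linD algebra_simps scale_right_diff_distrib)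

lemma qcomm_iter_zero: "lin X \<Longrightarrow> qcomm_iter Q X m c (\<lambda>v. 0) = (\<lambda>v. 0)"
  by (induction m arbitrary: c) (simp_all add: qcomm_def linD)

lemma qcomm_iter_add_scale:
  assumes "lin X"
  shows "qcomm_iter Q X m c (\<lambda>v. S v + scale a (T v))
       = (\<lambda>v. qcomm_iter Q X m c S v + scale a (qcomm_iter Q X m c T v))"
proof (induction m arbitrary: c S T)
  case (Suc m)
  have "qcomm c X (\<lambda>v. S v + scale a (T v)) = (\<lambda>v. qcomm c X S v + scale a (qcomm c X T v))"
    using assms by (simp add: qcomm_def fun_eq_iff linD scale_right_distrib scale_right_diff_distrib mult.commute)
  then show ?case by (simp add: Suc)
qed simp

text \<open>The Leibniz rule: the parameter of a product is the product of the parameters.\<close>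

lemma qcomm_comp:
  assumes "lin X" "lin S" "lin T"
  shows "qcomm (s * t) X (\<lambda>v. S (T v)) = (\<lambda>v. qcomm s X S (T v) + scale s (S (qcomm t X T v)))"
  using assms by (simp add: qcomm_def fun_eq_iff linD scale_right_diff_distrib)

text \<open>
  By the Leibniz rule each of the \<open>m\<close> commutators falls either on \<open>S\<close> or on \<open>T\<close>, and advances the
  parameter of the factor that it falls on. If \<open>m \<ge> a + b - 1\<close>, then \<open>S\<close> receives at least \<open>a\<close> of them or
  \<open>T\<close> at least \<open>b\<close>.
\<close>

lemma qcomm_iter_comp_eq_0:
  assumes "lin X" "lin S" "lin T"
    and "qcomm_iter Q X a s S = (\<lambda>v. 0)" "qcomm_iter Q X b t T = (\<lambda>v. 0)"
    and "a + b \<le> Suc m"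
  shows "qcomm_iter Q X m (s * t) (\<lambda>v. S (T v)) = (\<lambda>v. 0)"
  using assms
proof (induction m arbitrary: s t a b S T)
  case 0
  then have "a = 0 \<or> b = 0" by auto
  then show ?case using 0 by (auto simp: fun_eq_iff linD)
next
  case (Suc m)
  show ?case
  proof (cases "a = 0 \<or> b = 0")
    case True
    then have "(\<lambda>v. S (T v)) = (\<lambda>v. 0)" using Suc.prems by (auto simp: fun_eq_iff linD)
    then show ?thesis using Suc.prems by (simp add: qcomm_iter_zero del: qcomm_iter.simps)
  next
    case False
    then obtain a' b' where ab: "a = Suc a'" "b = Suc b'" by (meson not0_implies_Suc)
    have 1: "qcomm_iter Q X m (s * Q * t) (\<lambda>v. qcomm s X S (T v)) = (\<lambda>v. 0)"
      by (rule Suc.IH[of _ _ a' _ b]) (use Suc.prems ab in \<open>auto simp: lin_qcomm\<close>)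
    have 2: "qcomm_iter Q X m (s * (t * Q)) (\<lambda>v. S (qcomm t X T v)) = (\<lambda>v. 0)"
      by (rule Suc.IH[of _ _ a _ b']) (use Suc.prems ab in \<open>auto simp: lin_qcomm\<close>)
    have "qcomm_iter Q X (Suc m) (s * t) (\<lambda>v. S (T v))
      = qcomm_iter Q X m (s * t * Q) (\<lambda>v. qcomm s X S (T v) + scale s (S (qcomm t X T v)))"
      using Suc.prems by (simp add: qcomm_comp)
    also have "\<dots> = (\<lambda>v. 0)"
      using 1 2 Suc.prems(1) by (simp add: qcomm_iter_add_scale mult_ac)
    finally show ?thesis .
  qed
qed

lemma q_bracket_3: "q_bracket q 3 = q ^ 2 + 1 + inverse (q ^ 2)"
proof -
  have "q ^ 2 \<noteq> 1" using q_not_root_of_unity[of 2] by simp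
  then have "q - inverse q \<noteq> 0" using q_nonzero by (simp add: power2_eq_square field_simps)
  then show ?thesis using q_nonzero unfolding q_bracket_def
    by (simp add: field_simps) (simp add: algebra_simps power_numeral_reduce)
qed

text \<open>
  For \<open>n = 1\<close> this is the Serre relation itself; each further factor \<open>Y\<close> costs two more commutators and
  divides the initial parameter by \<open>Q\<close>.
\<close>

lemma q_serre_power:
  assumes "lin X" "lin Y" "q_serre scale q X Y"
  shows "qcomm_iter (q ^ 2) X (2 * n + 1) (inverse (q ^ 2) ^ n) (Y ^^ n) = (\<lambda>v. 0)"
proof (induction n)
  case 0
  show ?case by (simp add: qcomm_def)
next
  case (Suc n)
  let ?Q = "q ^ 2"
  have Q: "?Q \<noteq> 0" using q_nonzero by simp
  have "qcomm_iter ?Q X 3 (inverse ?Q) Y v = 0" for v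
  proof -
    have "qcomm_iter ?Q X 3 (inverse ?Q) Y v
        = (X ^^ 3) (Y v) - scale (q_bracket q 3) ((X ^^ 2) (Y (X v)))
          + scale (q_bracket q 3) (X (Y ((X ^^ 2) v))) - Y ((X ^^ 3) v)"
      using assms(1,2) Q unfolding q_bracket_3
      by (simp add: numeral_3_eq_3 numeral_2_eq_2 qcomm_def linD scale_right_diff_distrib
           scale_right_distrib scale_left_distrib flip: power_Suc2)
         (simp add: algebra_simps)
    then show ?thesis using assms(3) unfolding q_serre_def by simp
  qed
  then have 3: "qcomm_iter ?Q X 3 (inverse ?Q) Y = (\<lambda>v. 0)" by (simp add: fun_eq_iff)
  have "qcomm_iter ?Q X (2 * Suc n + 1) (inverse ?Q * inverse ?Q ^ n) (\<lambda>v. Y ((Y ^^ n) v)) = (\<lambda>v. 0)"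
    by (rule qcomm_iter_comp_eq_0[OF assms(1,2) lin_funpow[OF assms(2)] 3 Suc.IH]) simp
  then show ?case by (simp add: o_def)
qed

text \<open>
  Formally \<open>p\<close> is evaluated at the quotient of left by right multiplication with \<open>X\<close>, made homogeneous
  of degree \<open>N\<close>. A linear factor of \<open>p\<close> then acts on \<open>T\<close> as one \<open>q\<close>-commutator, so if \<open>p\<close> vanishes at the
  parameters of \<open>K\<close> commutators that kill \<open>T\<close>, the value is zero.
\<close>

lemma qcomm_iter_poly:
  assumes "lin X" "qcomm_iter Q X K c T = (\<lambda>v. 0)" "lin T"
    and "degree p \<le> N" "\<And>j. j < K \<Longrightarrow> poly p (c * Q ^ j) = 0"
    and "inj_on (\<lambda>j. c * Q ^ j) {..<K}"
  shows "(\<Sum>i\<le>N. scale (coeff p i) ((X ^^ i) (T ((X ^^ (N - i)) g)))) = 0"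
  using assms
proof (induction K arbitrary: c T p N)
  case 0
  have "(X ^^ i) 0 = 0" for i using lin_funpow[OF assms(1)] by (simp add: linD)
  then show ?case using 0 by (simp add: fun_eq_iff)
next
  case (Suc K)
  have "poly p c = 0" using Suc.prems(5)[of 0] by simp
  then obtain r where p: "p = [:- c, 1:] * r" by (auto simp: poly_eq_0_iff_dvd)
  show ?case
  proof (cases "r = 0")
    case False
    then have deg: "degree p = Suc (degree r)" unfolding p by (subst degree_mult_eq) auto
    then obtain M where N: "N = Suc M" and dr: "degree r \<le> M" using Suc.prems(4) by (cases N) auto
    have co: "coeff p 0 = - c * coeff r 0" "coeff p (Suc i) = coeff r i - c * coeff r (Suc i)" for i
      unfolding p by simp_all
    let ?t = "\<lambda>i. (X ^^ i) (T ((X ^^ (N - i)) g))"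
    have top: "coeff r (Suc M) = 0" using dr by (simp add: coeff_eq_0)
    \<comment> \<open>Split off the factor \<open>x - c\<close> and collect the terms with the same coefficient of \<open>r\<close>.\<close>
    have "(\<Sum>i\<le>N. scale (coeff p i) (?t i)) =
      scale (coeff p 0) (?t 0) + (\<Sum>i\<le>M. scale (coeff p (Suc i)) (?t (Suc i)))"
      unfolding N by (simp only: sum.atMost_Suc_shift)
    also have "(\<Sum>i\<le>M. scale (coeff p (Suc i)) (?t (Suc i))) =
       (\<Sum>i\<le>M. scale (coeff r i) (?t (Suc i))) - (\<Sum>i\<le>M. scale (c * coeff r (Suc i)) (?t (Suc i)))"
      unfolding co by (simp only: scale_left_diff_distrib sum_subtractf)
    also have "scale (coeff p 0) (?t 0) + (\<dots>) = (\<Sum>i\<le>M. scale (coeff r i) (?t (Suc i)))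
         - (\<Sum>i\<le>Suc M. scale (c * coeff r i) (?t i))"
      unfolding sum.atMost_Suc_shift co by (simp add: algebra_simps)
    also have "\<dots> = (\<Sum>i\<le>M. scale (coeff r i) (?t (Suc i) - scale c (?t i)))"
      using top by (simp add: sum_subtractf scale_right_diff_distrib mult.commute)
    also have "\<dots> = (\<Sum>i\<le>M. scale (coeff r i) ((X ^^ i) (qcomm c X T ((X ^^ (M - i)) g))))"
    proof (intro sum.cong refl arg_cong2[where f = scale])
      fix i assume "i \<in> {..M}"
      then have "N - i = Suc (M - i)" "N - Suc i = M - i" using N by auto
      then show "?t (Suc i) - scale c (?t i) = (X ^^ i) (qcomm c X T ((X ^^ (M - i)) g))"
        using linD[OF lin_funpow[OF \<open>lin X\<close>, of i]]
        by (simp add: qcomm_def funpow_swap1)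
    qed
    also have "\<dots> = 0"
    proof (rule Suc.IH[of "c * Q"])
      show "qcomm_iter Q X K (c * Q) (qcomm c X T) = (\<lambda>v. 0)" using Suc.prems by simp
      show "lin (qcomm c X T)" using Suc.prems lin_qcomm by blast
      show "inj_on (\<lambda>j. c * Q * Q ^ j) {..<K}"
        using Suc.prems(6) unfolding inj_on_def by (fastforce simp: mult.assoc simp flip: power_Suc)
      fix j assume j: "j < K"
      have "c * Q ^ 0 \<noteq> c * Q ^ Suc j"
        using inj_onD[OF Suc.prems(6), of 0 "Suc j"] j by auto
      moreover have "poly p (c * Q ^ Suc j) = 0" using Suc.prems(5) j by blast
      ultimately show "poly r (c * Q * Q ^ j) = 0"
        unfolding p by (auto simp: mult.assoc)
    qed (use Suc.prems dr in auto)
    finally show ?thesis .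
  qed (simp add: p)
qed

lemma q_power_eq_iff: "q ^ i = q ^ j \<longleftrightarrow> i = j"
proof -
  have "i = j" if "q ^ i = q ^ j" "i \<le> j" for i j
  proof -
    have "q ^ i * q ^ (j - i) = q ^ j" using that(2) by (simp flip: power_add)
    then have "q ^ i * q ^ (j - i) = q ^ i * 1" using that(1) by simp
    then have "q ^ (j - i) = 1" using q_nonzero by simp
    then have "\<not> j - i > 0" using q_not_root_of_unity by blast
    then show ?thesis using that by simp
  qed
  then show ?thesis by (metis nat_le_linear)
qed

lemma q_serre_sum_eq_0:
  assumes "lin X" "lin Y" "q_serre scale q X Y"
    and h: "\<And>j. j \<le> 2 * n \<Longrightarrow> (\<Sum>i\<le>N. h i * (inverse (q ^ 2) ^ n * (q ^ 2) ^ j) ^ i) = 0"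
  shows "(\<Sum>i\<le>N. scale (h i) ((X ^^ i) ((Y ^^ n) ((X ^^ (N - i)) g)))) = 0"
proof -
  define p where "p = (\<Sum>i\<le>N. monom (h i) i)"
  have co: "coeff p i = h i" if "i \<le> N" for i
    using that by (simp add: p_def coeff_sum)
  have "(\<Sum>i\<le>N. scale (coeff p i) ((X ^^ i) ((Y ^^ n) ((X ^^ (N - i)) g)))) = 0"
  proof (rule qcomm_iter_poly[OF assms(1) q_serre_power[OF assms(1-3)] lin_funpow[OF assms(2)]])
    show "degree p \<le> N"
      unfolding p_def by (intro degree_sum_le) (auto intro: order.trans[OF degree_monom_le])
    show "poly p (inverse (q ^ 2) ^ n * (q ^ 2) ^ j) = 0" if "j < 2 * n + 1" for j
      using h[of j] that by (simp add: p_def poly_sum poly_monom)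
    show "inj_on (\<lambda>j. inverse (q ^ 2) ^ n * (q ^ 2) ^ j) {..<2 * n + 1}"
      using q_nonzero by (auto simp: inj_on_def q_power_eq_iff simp flip: power_mult)
  qed
  moreover have "(\<Sum>i\<le>N. scale (coeff p i) ((X ^^ i) ((Y ^^ n) ((X ^^ (N - i)) g))))
      = (\<Sum>i\<le>N. scale (h i) ((X ^^ i) ((Y ^^ n) ((X ^^ (N - i)) g))))"
    by (intro sum.cong) (simp_all add: co)
  ultimately show ?thesis by simp
qed

text \<open>
  The values at the positions \<open>0, \<dots>, n - 1\<close> and \<open>N - n, \<dots>, N\<close> determine all others, with weights
  that depend on \<open>n\<close>, \<open>N\<close>, \<open>a\<close>, \<open>q\<close> only. The same weights serve the sequence read from right to left,
  since the set of parameters \<open>Q\<^sup>j\<close>, \<open>-n \<le> j \<le> n\<close>, is closed under inversion. These positions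
  are chosen because the exponents \<open>p\<close>, \<open>N - p\<close> are at least as unequal there as at any other position, which
  makes the straightening below terminate.
\<close>

lemma q_serre_interpolation:
  assumes "2 * n \<le> N" "a \<le> N"
  shows "\<exists>l. \<forall>X Y g. lin X \<longrightarrow> lin Y \<longrightarrow> q_serre scale q X Y \<longrightarrow>
     (X ^^ a) ((Y ^^ n) ((X ^^ (N - a)) g))
       = (\<Sum>p\<in>{..<n} \<union> {N - n..N}. scale (l p) ((X ^^ p) ((Y ^^ n) ((X ^^ (N - p)) g)))) \<and>
     (X ^^ (N - a)) ((Y ^^ n) ((X ^^ a) g))
       = (\<Sum>p\<in>{..<n} \<union> {N - n..N}. scale (l p) ((X ^^ (N - p)) ((Y ^^ n) ((X ^^ p) g))))"
proof -
  define Q where "Q = q ^ 2"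
  define x where "x = (\<lambda>j. inverse Q ^ n * Q ^ j)"
  have Q: "Q \<noteq> 0" using q_nonzero by (simp add: Q_def)
  define P where "P = {..<n} \<union> {N - n..N}"
  have PN: "P \<subseteq> {..N}" using assms by (auto simp: P_def)
  have "card P = 2 * n + 1"
    unfolding P_def using assms by (subst card_Un_disjoint) auto
  moreover have "inj_on (\<lambda>p. Q ^ p) P"
    by (auto simp: inj_on_def Q_def q_power_eq_iff simp flip: power_mult)
  ultimately obtain l0 where l0: "\<And>k. k \<le> 2 * n \<Longrightarrow> (\<Sum>p\<in>P. l0 p * (Q ^ p) ^ k) = (Q ^ a) ^ k"
    using interpolation_weights[of P "\<lambda>p. Q ^ p" "Q ^ a"] by (auto simp: P_def less_Suc_eq_le)
  define l where "l = (\<lambda>p. l0 p * Q ^ (p * n) * inverse Q ^ (a * n))"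
  \<comment> \<open>\<open>h\<close> lists the coefficients of \<open>x\<^sup>a - \<Sum>\<^sub>p l\<^sub>p x\<^sup>p\<close>, a polynomial vanishing at every \<open>x j\<close>; the factors in
    \<open>l\<close> turn the exponents \<open>0, \<dots>, 2 n\<close> of the interpolated monomials into \<open>-n, \<dots>, n\<close>.\<close>
  define h where "h = (\<lambda>i. (if i = a then 1 else 0) - (if i \<in> P then l i else 0))"
  have h_scale: "(\<Sum>i\<le>N. scale (h i) (w i)) = w a - (\<Sum>p\<in>P. scale (l p) (w p))" for w :: "nat \<Rightarrow> 'b"
  proof -
    have "(\<Sum>i\<le>N. scale (h i) (w i)) = (\<Sum>i\<le>N. if i = a then w i else 0)
        - (\<Sum>i\<le>N. if i \<in> P then scale (l i) (w i) else 0)"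
      unfolding h_def scale_left_diff_distrib sum_subtractf
      by (intro arg_cong2[where f = "(-)"] sum.cong) auto
    also have "(\<Sum>i\<le>N. if i \<in> P then scale (l i) (w i) else 0) = (\<Sum>p\<in>P. scale (l p) (w p))"
      using PN by (simp add: Int_absorb1 flip: sum.inter_restrict)
    finally show ?thesis using assms by simp
  qed
  have h_mult: "(\<Sum>i\<le>N. h i * w i) = w a - (\<Sum>p\<in>P. l p * w p)" for w :: "nat \<Rightarrow> 'a"
  proof -
    have "(\<Sum>i\<le>N. h i * w i) = (\<Sum>i\<le>N. if i = a then w i else 0)
        - (\<Sum>i\<le>N. if i \<in> P then l i * w i else 0)"
      unfolding h_def left_diff_distrib sum_subtractf
      by (intro arg_cong2[where f = "(-)"] sum.cong) auto
    also have "(\<Sum>i\<le>N. if i \<in> P then l i * w i else 0) = (\<Sum>p\<in>P. l p * w p)"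
      using PN by (simp add: Int_absorb1 flip: sum.inter_restrict)
    finally show ?thesis using assms by simp
  qed
  have root: "(\<Sum>i\<le>N. h i * x j ^ i) = 0" if "j \<le> 2 * n" for j
  proof -
    have "(\<Sum>p\<in>P. l p * x j ^ p) = inverse Q ^ (a * n) * (\<Sum>p\<in>P. l0 p * (Q ^ p) ^ j)"
      unfolding sum_distrib_left l_def x_def using Q
      by (intro sum.cong refl) (simp add: power_mult_distrib field_simps flip: power_mult)
    also have "\<dots> = x j ^ a"
      using Q l0[OF that] by (simp add: x_def power_mult_distrib field_simps flip: power_mult)
    finally show ?thesis by (simp add: h_mult)
  qed
  \<comment> \<open>The reversed polynomial has the inverse roots, which are the same roots.\<close>
  have root': "(\<Sum>i\<le>N. h (N - i) * x j ^ i) = 0" if "j \<le> 2 * n" for j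
  proof -
    have inv: "x j * x (2 * n - j) = 1"
      using that Q by (simp add: x_def field_simps flip: power_add mult_2)
    have "(\<Sum>i\<le>N. h (N - i) * x j ^ i) = (\<Sum>i\<le>N. h i * x j ^ (N - i))"
      by (rule sum.reindex_bij_witness[of _ "\<lambda>i. N - i" "\<lambda>i. N - i"]) auto
    also have "\<dots> = (\<Sum>i\<le>N. x j ^ N * (h i * x (2 * n - j) ^ i))"
    proof (intro sum.cong refl)
      fix i assume "i \<in> {..N}"
      then have "x j ^ N * x (2 * n - j) ^ i = x j ^ (N - i) * (x j * x (2 * n - j)) ^ i"
        by (simp add: power_mult_distrib mult.assoc[symmetric] flip: power_add)
      then have "x j ^ N * x (2 * n - j) ^ i = x j ^ (N - i)" unfolding inv by simp
      then show "h i * x j ^ (N - i) = x j ^ N * (h i * x (2 * n - j) ^ i)"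
        by (metis mult.left_commute)
    qed
    also have "\<dots> = 0" using root[of "2 * n - j"] by (simp flip: sum_distrib_left)
    finally show ?thesis .
  qed
  show ?thesis
  proof (intro exI[of _ l] allI impI conjI)
    fix X Y :: "'b \<Rightarrow> 'b" and g
    assume XY: "lin X" "lin Y" "q_serre scale q X Y"
    have "(\<Sum>i\<le>N. scale (h i) ((X ^^ i) ((Y ^^ n) ((X ^^ (N - i)) g)))) = 0"
      by (rule q_serre_sum_eq_0[OF XY]) (use root in \<open>simp add: x_def Q_def\<close>)
    then show "(X ^^ a) ((Y ^^ n) ((X ^^ (N - a)) g))
       = (\<Sum>p\<in>{..<n} \<union> {N - n..N}. scale (l p) ((X ^^ p) ((Y ^^ n) ((X ^^ (N - p)) g))))"
      unfolding h_scale P_def by simp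
    have "(\<Sum>i\<le>N. scale (h (N - i)) ((X ^^ i) ((Y ^^ n) ((X ^^ (N - i)) g)))) = 0"
      by (rule q_serre_sum_eq_0[OF XY]) (use root' in \<open>simp add: x_def Q_def\<close>)
    also have "(\<Sum>i\<le>N. scale (h (N - i)) ((X ^^ i) ((Y ^^ n) ((X ^^ (N - i)) g))))
      = (\<Sum>i\<le>N. scale (h i) ((X ^^ (N - i)) ((Y ^^ n) ((X ^^ i) g))))"
      by (rule sum.reindex_bij_witness[of _ "\<lambda>i. N - i" "\<lambda>i. N - i"]) auto
    finally show "(X ^^ (N - a)) ((Y ^^ n) ((X ^^ a) g))
       = (\<Sum>p\<in>{..<n} \<union> {N - n..N}. scale (l p) ((X ^^ (N - p)) ((Y ^^ n) ((X ^^ p) g))))"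
      unfolding h_scale P_def by simp
  qed
qed

text \<open>
  For fixed \<open>m = j + k\<close> let \<open>F a b = L\<^sup>a R\<^sup>b L\<^sup>m\<^sup>-\<^sup>a R\<^sup>m\<^sup>-\<^sup>b f\<close>. The claim is that \<open>F j j = F k k\<close>, and it follows
  from the stronger symmetry \<open>F a b = F (m - b) (m - a)\<close>. For fixed \<open>b\<close>, both sides are sequences in
  \<open>a\<close> obeying the higher Serre relation with \<open>n = b\<close>, hence it is enough to compare them at \<open>2 b + 1\<close>
  positions: for \<open>a < b\<close> both vanish, \<open>a = m - b\<close> is a fixed point of the symmetry, and for
  \<open>a > m - b\<close> the symmetry leads to the smaller second argument \<open>m - a < b\<close>.
\<close>

lemma raise_lower_commute:
  assumes lin: "lin R" "lin L"
    and serre: "q_serre scale q R L" "q_serre scale q L R"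
    and van: "\<And>a b. b < a \<Longrightarrow> (L ^^ a) ((R ^^ b) f) = 0"
  shows "(L ^^ j) ((R ^^ j) ((L ^^ k) ((R ^^ k) f))) = (L ^^ k) ((R ^^ k) ((L ^^ j) ((R ^^ j) f)))"
proof -
  have zero: "(R ^^ a) 0 = 0" "(L ^^ a) 0 = 0" for a
    using lin lin_funpow linD(4) by blast+
  have main: "(L ^^ j) ((R ^^ j) ((L ^^ k) ((R ^^ k) f))) = (L ^^ k) ((R ^^ k) ((L ^^ j) ((R ^^ j) f)))"
    if "j \<le> k" for j k
  proof -
    define m where "m = j + k"
    define F where "F = (\<lambda>a b. (L ^^ a) ((R ^^ b) ((L ^^ (m - a)) ((R ^^ (m - b)) f))))"
    have F0: "F a b = 0" if "a < b" "b \<le> m" for a b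
      using that by (simp add: F_def van zero)
    have sym: "F a b = F (m - b) (m - a)" if "2 * b \<le> m" "a \<le> m" for a b
      using that
    proof (induction b arbitrary: a rule: less_induct)
      case (less b)
      obtain l where l: "\<And>X Y g. lin X \<Longrightarrow> lin Y \<Longrightarrow> q_serre scale q X Y \<Longrightarrow>
         (X ^^ a) ((Y ^^ b) ((X ^^ (m - a)) g))
           = (\<Sum>p\<in>{..<b} \<union> {m - b..m}. scale (l p) ((X ^^ p) ((Y ^^ b) ((X ^^ (m - p)) g)))) \<and>
         (X ^^ (m - a)) ((Y ^^ b) ((X ^^ a) g))
           = (\<Sum>p\<in>{..<b} \<union> {m - b..m}. scale (l p) ((X ^^ (m - p)) ((Y ^^ b) ((X ^^ p) g))))"
        using q_serre_interpolation[OF less.prems] by blast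
      have 1: "F a b = (\<Sum>p\<in>{..<b} \<union> {m - b..m}. scale (l p) (F p b))"
        unfolding F_def using l[OF lin(2,1) serre(2)] by blast
      have "F (m - b) (m - a) = (L ^^ (m - b)) ((R ^^ (m - a)) ((L ^^ b) ((R ^^ a) f)))"
        unfolding F_def using less.prems by simp
      also have "\<dots> = (\<Sum>p\<in>{..<b} \<union> {m - b..m}. scale (l p)
           ((L ^^ (m - b)) ((R ^^ (m - p)) ((L ^^ b) ((R ^^ p) f)))))"
        using l[OF lin serre(1)] by (simp add: linD[OF lin_funpow[OF lin(2)]])
      also have "\<dots> = (\<Sum>p\<in>{..<b} \<union> {m - b..m}. scale (l p) (F (m - b) (m - p)))"
        using less.prems by (intro sum.cong refl) (auto simp: F_def)
      finally have 2: "F (m - b) (m - a) = (\<Sum>p\<in>{..<b} \<union> {m - b..m}. scale (l p) (F (m - b) (m - p)))" .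
      have "F p b = F (m - b) (m - p)" if p: "p \<in> {..<b} \<union> {m - b..m}" for p
      proof -
        consider "p < b" | "p = m - b" | "p > m - b" "p \<le> m" using p by fastforce
        then show ?thesis
        proof cases
          case 1
          then show ?thesis using less.prems by (simp add: F0)
        next
          case 2
          then show ?thesis using less.prems by simp
        next
          case 3
          then have "F (m - b) (m - p) = F (m - (m - p)) (m - (m - b))"
            using less.prems by (intro less.IH) auto
          then show ?thesis using 3 less.prems by simp
        qed
      qed
      then show ?case unfolding 1 2 by (intro sum.cong) auto
    qed
    have "F j j = F (m - j) (m - j)" using that by (intro sym) (auto simp: m_def)
    then show ?thesis by (simp add: F_def m_def)
  qed
  show ?thesis using main[of j k] main[of k j] by (cases "j \<le> k") auto
qed

end

section \<open>Straightening alternating words\<close>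

text \<open>The first exponent of the list belongs to the power of \<open>X\<close> that acts first. Zero exponents are
  admitted, so that rewriting preserves the length of the list.\<close>

primrec alt_word :: "('v \<Rightarrow> 'v) \<Rightarrow> ('v \<Rightarrow> 'v) \<Rightarrow> nat list \<Rightarrow> 'v \<Rightarrow> 'v" where
  "alt_word X Y [] = (\<lambda>v. v)"
| "alt_word X Y (k # ks) = (\<lambda>v. alt_word Y X ks ((X ^^ k) v))"

lemma alt_word_append:
  "alt_word X Y (ks @ ls) v =
     (if even (length ks) then alt_word X Y ls else alt_word Y X ls) (alt_word X Y ks v)"
  by (induction ks arbitrary: X Y v) auto

lemma first_ascent:
  assumes "\<not> sorted_wrt (>) (es :: nat list)"
  shows "\<exists>zs n a xs. es = zs @ n # a # xs \<and> n \<le> a \<and> sorted_wrt (>) (zs @ [n])"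
  using assms
proof (induction es rule: rev_induct)
  case (snoc x es)
  show ?case
  proof (cases "sorted_wrt (>) es")
    case False
    then obtain zs n a xs where "es = zs @ n # a # xs \<and> n \<le> a \<and> sorted_wrt (>) (zs @ [n])"
      using snoc.IH by blast
    then show ?thesis by (intro exI[of _ zs] exI[of _ n] exI[of _ a] exI[of _ "xs @ [x]"]) simp
  next
    case True
    with snoc.prems have "es \<noteq> []" by auto
    then obtain zs n where es: "es = zs @ [n]" by (metis rev_exhaust)
    have "n \<le> x"
      using snoc.prems True unfolding es by (fastforce simp: sorted_wrt_append not_less)
    then show ?thesis using True es by (intro exI[of _ zs] exI[of _ n] exI[of _ x] exI[of _ "[]"]) simp
  qed
qed simp

primrec tail_weight :: "nat list \<Rightarrow> nat" where
  "tail_weight [] = 0"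
| "tail_weight (e # es) = length es * e + tail_weight es"

lemma tail_weight_append:
  "tail_weight (xs @ ys) = tail_weight xs + length ys * sum_list xs + tail_weight ys"
  by (induction xs) (auto simp: algebra_simps)

lemma sum_squares_le_square_sum: "sum_list (map (\<lambda>x. x ^ 2) xs) \<le> (sum_list xs :: nat) ^ 2"
  by (induction xs) (auto simp: power2_sum)

text \<open>
  Rewriting keeps the length and the sum of the exponents. It increases the sum of their squares,
  except when it merely moves a large exponent towards the end of the list, which lowers the tail
  weight. Cutting off a factor \<open>L\<^sup>a R\<^sup>n\<close> next to the generating vector lowers the length.
\<close>

definition straightening_order :: "(nat list \<times> nat list) set" where
  "straightening_order = measures
     [\<lambda>es. sum_list es + length es,
      \<lambda>es. sum_list es ^ 2 - sum_list (map (\<lambda>x. x ^ 2) es),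
      tail_weight]"

lemma wf_straightening_order: "wf straightening_order"
  by (simp add: straightening_order_def)

lemma straightening_order_step:
  assumes "n < b" "n \<le> a" "p \<in> {..<n} \<union> {a + b - n..a + b}"
  shows "(zs @ [a + b - p, n, p] @ xs, zs @ [b, n, a] @ xs) \<in> straightening_order"
proof -
  let ?new = "zs @ [a + b - p, n, p] @ xs" and ?old = "zs @ [b, n, a] @ xs"
  let ?sq = "\<lambda>es. sum_list (map (\<lambda>x. x ^ 2) es) :: nat"
  have p: "p \<le> a + b" using assms by auto
  have sum: "sum_list ?new = sum_list ?old" using p by simp
  have len: "length ?new = length ?old" by simp
  define c where "c = a + b - p"
  have c: "c + p = a + b" using p by (simp add: c_def)
  have key: "a ^ 2 + b ^ 2 < p ^ 2 + c ^ 2 \<or> (a ^ 2 + b ^ 2 = p ^ 2 + c ^ 2 \<and> a = n \<and> p = b \<and> c = n)"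
  proof -
    \<comment> \<open>At \<open>p < n\<close> both factors are negative, at \<open>p \<ge> a + b - n\<close> both are nonnegative.\<close>
    have e: "int p ^ 2 + int c ^ 2 - (int a ^ 2 + int b ^ 2) = 2 * ((int p - int a) * (int p - int b))"
    proof -
      have c': "int c = int a + int b - int p" using c by linarith
      show ?thesis unfolding c' by (simp add: power2_eq_square algebra_simps)
    qed
    consider "p < n" | "p \<ge> a + b - n" "p \<noteq> b \<or> a \<noteq> n" | "p = b" "a = n"
      using assms by fastforce
    then show ?thesis
    proof cases
      case 1
      then have "(int p - int a) * (int p - int b) > 0"
        using assms by (intro mult_neg_neg) auto
      then have "int (a ^ 2 + b ^ 2) < int (p ^ 2 + c ^ 2)" using e by simp
      then show ?thesis by linarith
    next
      case 2
      then have "(int p - int a) * (int p - int b) > 0"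
        using assms by (intro mult_pos_pos) auto
      then have "int (a ^ 2 + b ^ 2) < int (p ^ 2 + c ^ 2)" using e by simp
      then show ?thesis by linarith
    next
      case 3
      then show ?thesis using c by simp
    qed
  qed
  show ?thesis
  proof (cases "a ^ 2 + b ^ 2 < p ^ 2 + c ^ 2")
    case True
    then have "?sq ?old < ?sq ?new" by (simp add: c_def[symmetric])
    moreover have "?sq ?new \<le> sum_list ?old ^ 2"
      using sum_squares_le_square_sum[of ?new] unfolding sum .
    ultimately have "sum_list ?old ^ 2 - ?sq ?new < sum_list ?old ^ 2 - ?sq ?old"
      by linarith
    then show ?thesis
      unfolding straightening_order_def in_measures sum len by blast
  next
    case False
    then have eq: "a ^ 2 + b ^ 2 = p ^ 2 + c ^ 2" "a = n" "p = b" "c = n" using key by auto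
    then have sq: "?sq ?new = ?sq ?old" by (simp add: c_def[symmetric])
    have "tail_weight ?new < tail_weight ?old"
      using eq assms by (simp add: tail_weight_append c_def[symmetric] algebra_simps)
    then show ?thesis
      unfolding straightening_order_def in_measures sum len sq by blast
  qed
qed

context q_vector_space begin

lemma lin_alt_word: "lin X \<Longrightarrow> lin Y \<Longrightarrow> lin (alt_word X Y ks)"
  by (induction ks arbitrary: X Y) (auto intro!: linI simp: linD lin_funpow[THEN linD(1)] lin_funpow[THEN linD(3)])

text \<open>
  At the first ascent \<open>\<dots>, b, n, a, \<dots>\<close> with \<open>b > n \<le> a\<close> the word contains \<open>X\<^sup>a Y\<^sup>n X\<^sup>b\<close>, which interpolation
  replaces by words that come earlier in the straightening order. If the ascent is at the very start,
  the word starts with \<open>L\<^sup>a R\<^sup>n f\<close> where \<open>n \<le> a\<close>: this is a multiple of \<open>f\<close> when \<open>a = n\<close>, and otherwise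
  zero because \<open>L f = 0\<close>.
\<close>

lemma alt_word_straighten:
  assumes lin: "lin R" "lin L"
    and serre: "q_serre scale q R L" "q_serre scale q L R"
    and L0: "L f = 0"
    and eigen: "\<And>k. \<exists>c. (L ^^ k) ((R ^^ k) f) = scale c f"
  shows "alt_word R L es f \<in> span {alt_word R L ks f | ks. sorted_wrt (>) ks}"
proof (induction es rule: wf_induct_rule[OF wf_straightening_order])
  case (1 es)
  let ?S = "span {alt_word R L ks f | ks. sorted_wrt (>) ks}"
  show ?case
  proof (cases "sorted_wrt (>) es")
    case True
    then show ?thesis by (intro span_base) auto
  next
    case False
    then obtain zs n a xs where es: "es = zs @ n # a # xs" "n \<le> a" "sorted_wrt (>) (zs @ [n])"
      using first_ascent by blast
    show ?thesis
    proof (cases zs rule: rev_cases)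
      case Nil
      obtain c where c: "(L ^^ n) ((R ^^ n) f) = scale c f" using eigen by blast
      have "(L ^^ a) ((R ^^ n) f) = (L ^^ (a - n)) ((L ^^ n) ((R ^^ n) f))"
        using es(2) by (simp add: funpow_add[symmetric, THEN fun_cong, unfolded o_def])
      also have "\<dots> = scale c ((L ^^ (a - n)) f)"
        using c lin_funpow[OF lin(2)] by (simp add: linD)
      also have "\<dots> = scale (if a = n then c else 0) f"
      proof (cases "a - n")
        case (Suc m)
        then show ?thesis using L0 lin_funpow[OF lin(2), of m] by (auto simp: funpow_swap1 linD)
      qed (use es in auto)
      finally have "alt_word R L es f = scale (if a = n then c else 0) (alt_word R L xs f)"
        using es Nil lin_alt_word[OF lin] by (simp add: linD)
      moreover have "(xs, es) \<in> straightening_order"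
        using es Nil by (simp add: straightening_order_def)
      ultimately show ?thesis using 1 by (auto intro: span_scale span_zero)
    next
      case (snoc us b)
      have b: "n < b" using es snoc by (simp add: sorted_wrt_append)
      obtain X Y where XY: "lin X" "lin Y" "q_serre scale q X Y"
        and app: "\<And>ls. alt_word R L (us @ ls) f = alt_word X Y ls (alt_word R L us f)"
        using lin serre that[of R L] that[of L R] by (cases "even (length us)") (auto simp: alt_word_append)
      obtain l where l: "(X ^^ a) ((Y ^^ n) ((X ^^ (a + b - a)) (alt_word R L us f)))
         = (\<Sum>p\<in>{..<n} \<union> {a + b - n..a + b}. scale (l p) ((X ^^ p) ((Y ^^ n) ((X ^^ (a + b - p)) (alt_word R L us f)))))"
        using q_serre_interpolation[of n "a + b" a] XY b es(2) by fastforce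
      have "alt_word R L es f = alt_word Y X xs ((X ^^ a) ((Y ^^ n) ((X ^^ b) (alt_word R L us f))))"
        using es snoc by (simp add: app)
      also have "\<dots> = (\<Sum>p\<in>{..<n} \<union> {a + b - n..a + b}. scale (l p) (alt_word R L (us @ [a + b - p, n, p] @ xs) f))"
        unfolding app using l lin_alt_word[OF XY(2,1)] by (simp add: linD)
      also have "\<dots> \<in> ?S"
      proof (intro span_sum span_scale 1)
        fix p assume "p \<in> {..<n} \<union> {a + b - n..a + b}"
        then show "(us @ [a + b - p, n, p] @ xs, es) \<in> straightening_order"
          using straightening_order_step[OF b es(2), of p us xs] es snoc by simp
      qed
      finally show ?thesis .
    qed
  qed
qed

end

section \<open>Counting decreasing lists by alternating sum\<close>

primrec alt_sum :: "nat list \<Rightarrow> int" where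
  "alt_sum [] = 0"
| "alt_sum (k # ks) = int k - alt_sum ks"

definition decreasing_lists :: "nat \<Rightarrow> int \<Rightarrow> nat list set" where
  "decreasing_lists d i = {ks. sorted_wrt (>) ks \<and> set ks \<subseteq> {1..d} \<and> alt_sum ks = i}"

text \<open>A list either avoids \<open>Suc d\<close> or has it as its head, which flips the sign of the remaining sum.\<close>

lemma decreasing_lists_Suc:
  "decreasing_lists (Suc d) i
     = decreasing_lists d i \<union> (#) (Suc d) ` decreasing_lists d (int (Suc d) - i)"
proof (intro equalityI subsetI)
  fix ks assume ks: "ks \<in> decreasing_lists (Suc d) i"
  show "ks \<in> decreasing_lists d i \<union> (#) (Suc d) ` decreasing_lists d (int (Suc d) - i)"
  proof (cases "Suc d \<in> set ks")
    case False
    have "set ks \<subseteq> {1..d}"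
    proof
      fix x assume "x \<in> set ks"
      then have "x \<in> {1..Suc d}" "x \<noteq> Suc d"
        using ks False by (auto simp: decreasing_lists_def)
      then show "x \<in> {1..d}" by auto
    qed
    then show ?thesis using ks by (auto simp: decreasing_lists_def)
  next
    case True
    then obtain k ls where kls: "ks = k # ls" by (cases ks) auto
    have k: "k = Suc d"
      using ks True unfolding kls by (fastforce simp: decreasing_lists_def)
    have "set ls \<subseteq> {1..d}"
    proof
      fix x assume "x \<in> set ls"
      then have "x < k" "1 \<le> x" using ks unfolding kls by (auto simp: decreasing_lists_def)
      then show "x \<in> {1..d}" using k by auto
    qed
    then show ?thesis using ks k unfolding kls by (auto simp: decreasing_lists_def)
  qed
next
  fix ks assume "ks \<in> decreasing_lists d i \<union> (#) (Suc d) ` decreasing_lists d (int (Suc d) - i)"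
  then show "ks \<in> decreasing_lists (Suc d) i"
    by (force simp: decreasing_lists_def)
qed

lemma decreasing_lists_0: "decreasing_lists 0 i = (if i = 0 then {[]} else {})"
  by (auto simp: decreasing_lists_def)

lemma decreasing_lists_bounds: "ks \<in> decreasing_lists d i \<Longrightarrow> 0 \<le> i \<and> i \<le> int d"
proof (induction d arbitrary: i ks)
  case (Suc d)
  then show ?case unfolding decreasing_lists_Suc by fastforce
qed (auto simp: decreasing_lists_0 split: if_splits)

lemma finite_decreasing_lists: "finite (decreasing_lists d i)"
  by (induction d arbitrary: i) (auto simp: decreasing_lists_0 decreasing_lists_Suc)

text \<open>Pascal's rule, combined with the symmetry of the binomial coefficients for the lists that start
  with \<open>Suc d\<close>.\<close>

lemma card_decreasing_lists: "card (decreasing_lists d (int i)) \<le> d choose i"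
proof (induction d arbitrary: i)
  case 0
  show ?case by (simp add: decreasing_lists_0)
next
  case (Suc d)
  let ?B = "decreasing_lists d (int (Suc d) - int i)"
  have "card (decreasing_lists (Suc d) (int i)) \<le> card (decreasing_lists d (int i)) + card ?B"
    unfolding decreasing_lists_Suc
    by (rule order.trans[OF card_Un_le]) (simp add: card_image_le finite_decreasing_lists)
  also have "card ?B \<le> (case i of 0 \<Rightarrow> 0 | Suc k \<Rightarrow> d choose k)"
  proof (cases "i = 0 \<or> i > Suc d")
    case True
    then have "?B = {}" using decreasing_lists_bounds by fastforce
    then show ?thesis by simp
  next
    case False
    then obtain k where k: "i = Suc k" "k \<le> d" by (cases i) auto
    then have "card ?B = card (decreasing_lists d (int (d - k)))" by (simp add: of_nat_diff)
    also have "\<dots> \<le> d choose (d - k)" by (rule Suc.IH)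
    finally show ?thesis using k by (simp flip: binomial_symmetric)
  qed
  also have "card (decreasing_lists d (int i)) + \<dots> \<le> (d choose i) + \<dots>"
    using Suc.IH by simp
  also have "\<dots> = Suc d choose i" by (cases i) auto
  finally show ?case by simp
qed

section \<open>Common eigenvectors\<close>

locale q_vector_space_fd = q_vector_space scale q + finite_dimensional_vector_space scale Basis
  for scale :: "'a::alg_closed_field \<Rightarrow> 'b::ab_group_add \<Rightarrow> 'b" and q and Basis
begin

text \<open>The vectors \<open>v, T v, \<dots>, T\<^sup>n v\<close> with \<open>n\<close> the dimension are dependent; if two of them coincide, their
  difference is the required relation.\<close>

lemma exists_annihilating_poly:
  "\<exists>p. p \<noteq> 0 \<and> (\<Sum>i\<le>degree p. scale (coeff p i) ((T ^^ i) v)) = 0"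
proof -
  define n where "n = dim (UNIV :: 'b set)"
  let ?f = "\<lambda>i. (T ^^ i) v"
  have "\<exists>h :: nat \<Rightarrow> 'a. (\<exists>i\<le>n. h i \<noteq> 0) \<and> (\<Sum>i\<le>n. scale (h i) (?f i)) = 0"
  proof (cases "inj_on ?f {..n}")
    case True
    have "card (?f ` {..n}) = Suc n" using card_image[OF True] by simp
    then have "dependent (?f ` {..n})"
      using independent_card_le_dim[of "?f ` {..n}" UNIV] by (auto simp: n_def)
    then obtain u where u: "\<exists>w\<in>?f ` {..n}. u w \<noteq> 0" "(\<Sum>w\<in>?f ` {..n}. scale (u w) w) = 0"
      using dependent_finite[of "?f ` {..n}"] by auto
    have "(\<Sum>i\<le>n. scale (u (?f i)) (?f i)) = 0"
      using u(2) sum.reindex[OF True, of "\<lambda>w. scale (u w) w"] by simp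
    then show ?thesis using u(1) by (intro exI[of _ "\<lambda>i. u (?f i)"]) auto
  next
    case False
    then obtain i j where ij: "i \<le> n" "j \<le> n" "i \<noteq> j" "?f i = ?f j" by (auto simp: inj_on_def)
    define h :: "nat \<Rightarrow> 'a" where "h = (\<lambda>k. (if k = i then 1 else 0) - (if k = j then 1 else 0))"
    have "(\<Sum>k\<le>n. scale (h k) (?f k)) = (\<Sum>k\<le>n. if k = i then ?f k else 0) - (\<Sum>k\<le>n. if k = j then ?f k else 0)"
      unfolding h_def scale_left_diff_distrib sum_subtractf
      by (intro arg_cong2[where f = "(-)"] sum.cong) auto
    also have "\<dots> = 0" using ij by simp
    finally show ?thesis using ij by (intro exI[of _ h]) (auto simp: h_def)
  qed
  then obtain h :: "nat \<Rightarrow> 'a" where h: "\<exists>i\<le>n. h i \<noteq> 0" "(\<Sum>i\<le>n. scale (h i) (?f i)) = 0" by blast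
  define p where "p = (\<Sum>i\<le>n. monom (h i) i)"
  have co: "coeff p i = (if i \<le> n then h i else 0)" for i
    by (simp add: p_def coeff_sum)
  have "p \<noteq> 0" using h(1) co by (metis coeff_0)
  have "degree p \<le> n" by (rule degree_le) (simp add: co)
  then have "(\<Sum>i\<le>n. scale (coeff p i) (?f i)) = (\<Sum>i\<le>degree p. scale (coeff p i) (?f i))"
    by (intro sum.mono_neutral_right) (auto simp: coeff_eq_0)
  moreover have "(\<Sum>i\<le>n. scale (coeff p i) (?f i)) = 0"
    using h(2) by (simp add: co)
  ultimately show ?thesis using \<open>p \<noteq> 0\<close> by auto
qed

text \<open>Take an annihilating polynomial \<open>p\<close> of \<open>v\<close> of least degree and split off a root, \<open>p = (x - c) r\<close>.
  Then \<open>r\<close> evaluated at \<open>T\<close> sends \<open>v\<close> to an eigenvector, nonzero by minimality.\<close>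

lemma exists_eigenvector:
  assumes T: "lin T" and W: "subspace W" "W \<noteq> {0}" "T ` W \<subseteq> W"
  shows "\<exists>c. \<exists>w\<in>W. w \<noteq> 0 \<and> T w = scale c w"
proof -
  obtain v where v: "v \<in> W" "v \<noteq> 0" using W subspace_0 by blast
  let ?ev = "\<lambda>p. \<Sum>i\<le>degree p. scale (coeff p i) ((T ^^ i) v)"
  define ann where "ann = (\<lambda>p. p \<noteq> 0 \<and> ?ev p = 0)"
  obtain p0 where "ann p0" using exists_annihilating_poly[of T v] by (auto simp: ann_def)
  then obtain p where "ann p" and least: "\<And>r. ann r \<Longrightarrow> degree p \<le> degree r"
    using ex_has_least_nat[of ann p0 degree] by blast
  then have p: "p \<noteq> 0" "?ev p = 0" by (simp_all add: ann_def)
  have min: "?ev r \<noteq> 0" if "r \<noteq> 0" "degree r < degree p" for r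
  proof
    assume "?ev r = 0"
    then have "ann r" using that by (simp add: ann_def)
    then show False using least that by fastforce
  qed
  have "degree p > 0"
  proof (rule ccontr)
    assume "\<not> degree p > 0"
    then obtain a where "p = [:a:]" by (metis degree_eq_zeroE neq0_conv)
    then show False using p v by simp
  qed
  then obtain c where "poly p c = 0" using alg_closed_imp_poly_has_root by blast
  then obtain r where r: "p = [:- c, 1:] * r" by (auto simp: poly_eq_0_iff_dvd)
  have "r \<noteq> 0" using r p by auto
  then have deg: "degree p = Suc (degree r)" unfolding r by (subst degree_mult_eq) auto
  have co: "coeff p 0 = - c * coeff r 0" "coeff p (Suc i) = coeff r i - c * coeff r (Suc i)" for i
    unfolding r by simp_all
  define w where "w = ?ev r"
  have "w \<noteq> 0" using min[of r] \<open>r \<noteq> 0\<close> deg by (simp add: w_def)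
  have "(T ^^ i) v \<in> W" for i using v W by (induction i) auto
  then have "w \<in> W" unfolding w_def using W(1) by (intro subspace_sum subspace_scale) auto
  have "T w - scale c w = 0"
  proof -
    let ?N = "degree r"
    let ?f = "\<lambda>i. (T ^^ i) v"
    have top: "coeff r (Suc ?N) = 0" by (simp add: coeff_eq_0)
    have "?ev p = scale (coeff p 0) (?f 0) + (\<Sum>i\<le>?N. scale (coeff p (Suc i)) (?f (Suc i)))"
      unfolding deg by (simp only: sum.atMost_Suc_shift)
    also have "\<dots> = (\<Sum>i\<le>?N. scale (coeff r i) (?f (Suc i))) - (\<Sum>i\<le>Suc ?N. scale (c * coeff r i) (?f i))"
      unfolding sum.atMost_Suc_shift co by (simp add: scale_left_diff_distrib sum_subtractf)
    also have "\<dots> = T w - scale c w"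
    proof -
      have "T w = (\<Sum>i\<le>?N. scale (coeff r i) (?f (Suc i)))"
        unfolding w_def linD(6)[OF T] by (intro sum.cong refl) (simp add: linD(3)[OF T])
      then show ?thesis using top by (simp add: w_def scale_sum_right)
    qed
    finally show ?thesis using p by simp
  qed
  then show ?thesis using \<open>w \<in> W\<close> \<open>w \<noteq> 0\<close> by auto
qed

text \<open>On an invariant nonzero subspace of least dimension each operator is a scalar, since its eigenspaces
  there are invariant under the others.\<close>

lemma exists_common_eigenvector:
  assumes C: "\<And>k. lin (C k)" and W: "subspace W" "W \<noteq> {0}" "\<And>k. C k ` W \<subseteq> W"
    and comm: "\<And>j k w. w \<in> W \<Longrightarrow> C j (C k w) = C k (C j w)"
  shows "\<exists>w\<in>W. w \<noteq> 0 \<and> (\<forall>k. \<exists>c. C k w = scale c w)"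
proof -
  define good where "good = (\<lambda>M. subspace M \<and> M \<noteq> {0} \<and> M \<subseteq> W \<and> (\<forall>k. C k ` M \<subseteq> M))"
  have "good W" using W by (simp add: good_def)
  then obtain M where M: "good M" and min: "\<And>N. good N \<Longrightarrow> dim M \<le> dim N"
    using ex_has_least_nat[of good W dim] by blast
  have "\<exists>c. \<forall>x\<in>M. C k x = scale c x" for k
  proof -
    obtain c u where u: "u \<in> M" "u \<noteq> 0" "C k u = scale c u"
      using exists_eigenvector[OF C, of M k] M by (auto simp: good_def)
    define N where "N = {x \<in> M. C k x = scale c x}"
    have "good N" unfolding good_def
    proof (intro conjI allI)
      show "subspace N"
        using M linD[OF C[of k]] unfolding N_def good_def subspace_def
        by (auto simp: scale_right_distrib mult.commute)
      show "N \<noteq> {0}" using u by (auto simp: N_def)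
      show "N \<subseteq> W" using M by (auto simp: N_def good_def)
      fix j
      show "C j ` N \<subseteq> N"
      proof
        fix y assume "y \<in> C j ` N"
        then obtain x where x: "x \<in> M" "C k x = scale c x" "y = C j x" by (auto simp: N_def)
        have "x \<in> W" using x M by (auto simp: good_def)
        then have "C k y = scale c y" using comm[of x k j] x linD[OF C[of j]] by simp
        then show "y \<in> N" using x M by (auto simp: N_def good_def)
      qed
    qed
    moreover have "N \<subseteq> M" by (auto simp: N_def)
    ultimately have "N = M"
      using subspace_dim_equal[of N M] min[of N] M by (auto simp: good_def)
    then show ?thesis by (auto simp: N_def)
  qed
  moreover obtain w where "w \<in> M" "w \<noteq> 0" using M subspace_0 by (auto simp: good_def)
  moreover have "w \<in> W" using \<open>w \<in> M\<close> M by (auto simp: good_def)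
  ultimately show ?thesis by metis
qed

end

section \<open>Shifting the Serre relation\<close>

context q_vector_space begin

lemma funpow_numeral: "(X ^^ 2) v = X (X v)" "(X ^^ 3) v = X (X (X v))"
  by (simp_all add: numeral_3_eq_3 numeral_2_eq_2)

text \<open>
  Replacing \<open>A\<close> and \<open>B\<close> in each word by differences with scalars preserves the relation, provided that
  the scalars are those of a graded space: going up one degree multiplies the eigenvalue of \<open>A\<close> by
  \<open>Q\<close> and divides the one of \<open>B\<close> by \<open>Q\<close>. With this choice all terms of lower order cancel, without
  any assumption on \<open>x\<close>.
\<close>

lemma q_serre_shifted:
  assumes lin: "lin A" "lin B" and serre: "q_serre scale q A B"
  defines "Q \<equiv> q ^ 2"
  defines "A1 \<equiv> \<lambda>c v. A v - scale c v" and "B1 \<equiv> \<lambda>c v. B v - scale c v"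
  shows "A1 (Q ^ 2 * t) (A1 (Q * t) (A1 t (B1 (Q ^ 3 * s) x)))
     - scale (q_bracket q 3) (A1 (Q ^ 2 * t) (A1 (Q * t) (B1 (Q ^ 2 * s) (A1 (Q * t) x))))
     + scale (q_bracket q 3) (A1 (Q ^ 2 * t) (B1 (Q * s) (A1 (Q ^ 2 * t) (A1 (Q * t) x))))
     - B1 s (A1 (Q ^ 3 * t) (A1 (Q ^ 2 * t) (A1 (Q * t) x))) = 0" (is "?E = 0")
proof -
  have Q: "Q \<noteq> 0" using q_nonzero by (simp add: Q_def)
  have m: "Q * q_bracket q 3 = Q * Q + Q + 1"
    using q_bracket_3 Q
    by (simp add: Q_def[symmetric] field_simps)
  have S: "scale Q (A (A (A (B x)))) - scale (Q * Q + Q + 1) (A (A (B (A x))))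
     + scale (Q * Q + Q + 1) (A (B (A (A x)))) - scale Q (B (A (A (A x)))) = 0"
  proof -
    have "scale Q ((A ^^ 3) (B x) - scale (q_bracket q 3) ((A ^^ 2) (B (A x)))
          + scale (q_bracket q 3) (A (B ((A ^^ 2) x))) - B ((A ^^ 3) x)) = 0"
      using serre unfolding q_serre_def by simp
    then show ?thesis
      by (simp add: funpow_numeral scale_right_distrib scale_right_diff_distrib m)
  qed
  \<comment> \<open>Multiplying by \<open>Q\<close> clears the inverse in \<open>[3]\<close> and leaves a polynomial identity.\<close>
  have "scale Q ?E = scale Q (A1 (Q ^ 2 * t) (A1 (Q * t) (A1 t (B1 (Q ^ 3 * s) x))))
     - scale (Q * Q + Q + 1) (A1 (Q ^ 2 * t) (A1 (Q * t) (B1 (Q ^ 2 * s) (A1 (Q * t) x))))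
     + scale (Q * Q + Q + 1) (A1 (Q ^ 2 * t) (B1 (Q * s) (A1 (Q ^ 2 * t) (A1 (Q * t) x))))
     - scale Q (B1 s (A1 (Q ^ 3 * t) (A1 (Q ^ 2 * t) (A1 (Q * t) x))))"
    by (simp add: scale_right_distrib scale_right_diff_distrib m)
  also have "\<dots> = scale Q (A (A (A (B x)))) - scale (Q * Q + Q + 1) (A (A (B (A x))))
     + scale (Q * Q + Q + 1) (A (B (A (A x)))) - scale Q (B (A (A (A x))))"
    unfolding A1_def B1_def
    by (simp add: linD[OF lin(1)] linD[OF lin(2)] scale_right_distrib scale_right_diff_distrib
        scale_left_distrib power2_eq_square power3_eq_cube algebra_simps)
  finally show ?thesis using S Q by simp
qed

end

section \<open>The split decomposition\<close>

text \<open>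
  The families \<open>F\<close> and \<open>G\<close> are the flags attached to the two orderings of eigenspaces, extended
  constantly to all integers so that no boundary cases arise.
\<close>

locale split_pair = q_vector_space_fd scale q Basis
  for scale :: "'a::alg_closed_field \<Rightarrow> 'b::ab_group_add \<Rightarrow> 'b" and q and Basis +
  fixes A B :: "'b \<Rightarrow> 'b" and \<theta> \<theta>' :: "int \<Rightarrow> 'a" and F G :: "int \<Rightarrow> 'b set" and d :: nat
  assumes lin_A: "lin A" and lin_B: "lin B"
    and serre_AB: "q_serre scale q A B" and serre_BA: "q_serre scale q B A"
    and \<theta>_step: "\<theta> (j + 1) = q ^ 2 * \<theta> j" and \<theta>'_step: "\<theta>' j = q ^ 2 * \<theta>' (j + 1)"
    and subspace_F: "subspace (F i)" and subspace_G: "subspace (G i)"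
    and F_antimono: "i \<le> j \<Longrightarrow> F j \<subseteq> F i" and G_mono: "i \<le> j \<Longrightarrow> G i \<subseteq> G j"
    and F_UNIV: "i \<le> 0 \<Longrightarrow> F i = UNIV" and F_0: "i > int d \<Longrightarrow> F i = {0}"
    and G_0: "i < 0 \<Longrightarrow> G i = {0}"
    and A_F: "x \<in> F i \<Longrightarrow> A x - scale (\<theta> i) x \<in> F (i + 1)" and B_F: "x \<in> F i \<Longrightarrow> B x \<in> F (i - 1)"
    and B_G: "x \<in> G i \<Longrightarrow> B x - scale (\<theta>' i) x \<in> G (i - 1)" and A_G: "x \<in> G i \<Longrightarrow> A x \<in> G (i + 1)"
    and F_1: "F 1 \<noteq> UNIV" and G_nonzero: "G 0 \<noteq> {0}"
    and irreducible: "subspace W \<Longrightarrow> A ` W \<subseteq> W \<Longrightarrow> B ` W \<subseteq> W \<Longrightarrow> W = {0} \<or> W = UNIV"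
begin

lemma A_shift: "x \<in> G i \<Longrightarrow> x \<in> F j \<Longrightarrow> A x - scale (\<theta> j) x \<in> G (i + 1) \<inter> F (j + 1)"
  using A_F A_G G_mono[of i "i + 1"] subspace_G by (auto intro!: subspace_diff subspace_scale)

lemma B_shift: "x \<in> G i \<Longrightarrow> x \<in> F j \<Longrightarrow> B x - scale (\<theta>' i) x \<in> G (i - 1) \<inter> F (j - 1)"
  using B_F B_G F_antimono[of "j - 1" j] subspace_F by (auto intro!: subspace_diff subspace_scale)

text \<open>The sum of all \<open>G r \<inter> F (r + 1)\<close> is invariant under both maps and is contained in \<open>F 1\<close>, hence
  zero.\<close>

lemma G_Int_F_eq_0: "G i \<inter> F (i + 1) = {0}"
proof -
  define S where "S = (\<Union>r. G r \<inter> F (r + 1))"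
  have inS: "x \<in> span S" if "x \<in> G r" "x \<in> F (r + 1)" for x r
    using that by (intro span_base) (auto simp: S_def)
  have "A x \<in> span S" if x: "x \<in> S" for x
  proof -
    obtain r where r: "x \<in> G r" "x \<in> F (r + 1)" using x unfolding S_def by blast
    have "(A x - scale (\<theta> (r + 1)) x) + scale (\<theta> (r + 1)) x \<in> span S"
      using A_shift[OF r] r by (intro span_add span_scale inS[of _ r] inS[of _ "r + 1"]) auto
    then show ?thesis by simp
  qed
  moreover have "B x \<in> span S" if x: "x \<in> S" for x
  proof -
    obtain r where r: "x \<in> G r" "x \<in> F (r + 1)" using x unfolding S_def by blast
    have "(B x - scale (\<theta>' r) x) + scale (\<theta>' r) x \<in> span S"
      using B_shift[OF r] r by (intro span_add span_scale inS[of _ r] inS[of _ "r - 1"]) auto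
    then show ?thesis by simp
  qed
  ultimately have "span S = {0} \<or> span S = UNIV"
    using span_invariant lin_A lin_B by (intro irreducible) (auto simp: image_subset_iff)
  moreover have "S \<subseteq> F 1"
  proof
    fix x assume "x \<in> S"
    then obtain r where r: "x \<in> G r" "x \<in> F (r + 1)" by (auto simp: S_def)
    show "x \<in> F 1"
    proof (cases "r < 0")
      case True
      then have "x = 0" using r G_0 by auto
      then show ?thesis using subspace_0[OF subspace_F] by simp
    next
      case False
      then show ?thesis using r F_antimono[of 1 "r + 1"] by auto
    qed
  qed
  then have "span S \<subseteq> F 1" using subspace_F by (rule span_minimal)
  ultimately have "span S = {0}" using F_1 by auto
  then have "G i \<inter> F (i + 1) \<subseteq> {0}" using inS by auto
  then show ?thesis using subspace_0[OF subspace_F] subspace_0[OF subspace_G] by auto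
qed

definition U :: "int \<Rightarrow> 'b set" where "U i = G i \<inter> F i"

lemma subspace_U: "subspace (U i)"
  unfolding U_def by (intro subspace_inter subspace_G subspace_F)

lemma U_outside: "i < 0 \<or> i > int d \<Longrightarrow> U i = {0}"
  using G_0[of i] F_0[of i] subspace_0[OF subspace_F] subspace_0[OF subspace_G] by (auto simp: U_def)

text \<open>
  The raising and lowering maps depend on the component that they act on. They become single
  operators on families of vectors indexed by the degree, so it is not necessary to show first that
  the space is the direct sum of the components.
\<close>

definition fscale :: "'a \<Rightarrow> (int \<Rightarrow> 'b) \<Rightarrow> int \<Rightarrow> 'b" where
  "fscale c f = (\<lambda>i. scale c (f i))"

definition raise :: "(int \<Rightarrow> 'b) \<Rightarrow> int \<Rightarrow> 'b" where
  "raise f = (\<lambda>i. A (f (i - 1)) - scale (\<theta> (i - 1)) (f (i - 1)))"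

definition lower :: "(int \<Rightarrow> 'b) \<Rightarrow> int \<Rightarrow> 'b" where
  "lower f = (\<lambda>i. B (f (i + 1)) - scale (\<theta>' (i + 1)) (f (i + 1)))"

interpretation fn: q_vector_space fscale q
  by unfold_locales
    (auto simp: fscale_def fun_eq_iff scale_right_distrib scale_left_distrib q_nonzero q_not_root_of_unity)

lemma lin_raise: "fn.lin raise"
  by (rule fn.linI) (auto simp: fscale_def raise_def fun_eq_iff linD[OF lin_A] algebra_simps scale_right_diff_distrib)

lemma lin_lower: "fn.lin lower"
  by (rule fn.linI) (auto simp: fscale_def lower_def fun_eq_iff linD[OF lin_B] algebra_simps scale_right_diff_distrib)

lemma serre_raise_lower: "q_serre fscale q raise lower"
  unfolding q_serre_def
proof (intro allI, rule ext)
  fix f :: "int \<Rightarrow> 'b" and i :: int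
  define j where "j = i - 2"
  have th: "\<theta> j = q ^ 2 * \<theta> (j - 1)" "\<theta> (j + 1) = (q ^ 2) ^ 2 * \<theta> (j - 1)" "\<theta> (j + 2) = (q ^ 2) ^ 3 * \<theta> (j - 1)"
    using \<theta>_step[of "j - 1"] \<theta>_step[of j] \<theta>_step[of "j + 1"]
    by (simp_all add: power2_eq_square power3_eq_cube add.assoc mult.assoc)
  have th': "\<theta>' (j + 2) = q ^ 2 * \<theta>' (j + 3)" "\<theta>' (j + 1) = (q ^ 2) ^ 2 * \<theta>' (j + 3)" "\<theta>' j = (q ^ 2) ^ 3 * \<theta>' (j + 3)"
    using \<theta>'_step[of "j + 2"] \<theta>'_step[of j] \<theta>'_step[of "j + 1"]
    by (simp_all add: power2_eq_square power3_eq_cube add.assoc mult.assoc)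
  have e: "j + 1 = 1 + j" "j + 3 = 3 + j" by simp_all
  have i: "i = j + 2" by (simp add: j_def)
  show "((raise ^^ 3) (lower f) - fscale (q_bracket q 3) ((raise ^^ 2) (lower (raise f)))
      + fscale (q_bracket q 3) (raise (lower ((raise ^^ 2) f))) - lower ((raise ^^ 3) f)) i = 0 i"
    using q_serre_shifted[OF lin_A lin_B serre_AB, where t = "\<theta> (j - 1)" and s = "\<theta>' (j + 3)" and x = "f j",
      folded th th', unfolded e]
    unfolding funpow_numeral i
    by (simp add: raise_def lower_def fscale_def)
qed

lemma serre_lower_raise: "q_serre fscale q lower raise"
  unfolding q_serre_def
proof (intro allI, rule ext)
  fix f :: "int \<Rightarrow> 'b" and i :: int
  define j where "j = i + 2"
  have th': "\<theta>' j = q ^ 2 * \<theta>' (j + 1)" "\<theta>' (j - 1) = (q ^ 2) ^ 2 * \<theta>' (j + 1)" "\<theta>' (j - 2) = (q ^ 2) ^ 3 * \<theta>' (j + 1)"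
    using \<theta>'_step[of "j - 1"] \<theta>'_step[of j] \<theta>'_step[of "j - 2"]
    by (simp_all add: power2_eq_square power3_eq_cube add.assoc mult.assoc)
  have th: "\<theta> (j - 2) = q ^ 2 * \<theta> (j - 3)" "\<theta> (j - 1) = (q ^ 2) ^ 2 * \<theta> (j - 3)" "\<theta> j = (q ^ 2) ^ 3 * \<theta> (j - 3)"
    using \<theta>_step[of "j - 2"] \<theta>_step[of "j - 3"] \<theta>_step[of "j - 1"]
    by (simp_all add: power2_eq_square power3_eq_cube add.assoc mult.assoc)
  have e: "j + 1 = 1 + j" by simp
  have i: "i = j - 2" by (simp add: j_def)
  show "((lower ^^ 3) (raise f) - fscale (q_bracket q 3) ((lower ^^ 2) (raise (lower f)))
      + fscale (q_bracket q 3) (lower (raise ((lower ^^ 2) f))) - raise ((lower ^^ 3) f)) i = 0 i"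
    using q_serre_shifted[OF lin_B lin_A serre_BA, where t = "\<theta>' (j + 1)" and s = "\<theta> (j - 3)" and x = "f j",
      folded th th', unfolded e]
    unfolding funpow_numeral i
    by (simp add: raise_def lower_def fscale_def)
qed

definition single :: "int \<Rightarrow> 'b \<Rightarrow> int \<Rightarrow> 'b" where
  "single i x = (\<lambda>j. if j = i then x else 0)"

definition homogeneous :: "int \<Rightarrow> (int \<Rightarrow> 'b) set" where
  "homogeneous i = single i ` U i"

lemma homogeneousD: "f \<in> homogeneous i \<Longrightarrow> f = single i (f i) \<and> f i \<in> U i"
  by (auto simp: homogeneous_def single_def)

lemma raise_homogeneous: "f \<in> homogeneous i \<Longrightarrow> raise f \<in> homogeneous (i + 1)"
proof -
  assume "f \<in> homogeneous i"
  then obtain x where x: "x \<in> U i" "f = single i x" by (auto simp: homogeneous_def)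
  have "raise f = single (i + 1) (A x - scale (\<theta> i) x)"
    using x by (auto simp: raise_def single_def fun_eq_iff linD[OF lin_A])
  then show ?thesis using A_shift[of x i i] x by (auto simp: homogeneous_def U_def)
qed

lemma lower_homogeneous: "f \<in> homogeneous i \<Longrightarrow> lower f \<in> homogeneous (i - 1)"
proof -
  assume "f \<in> homogeneous i"
  then obtain x where x: "x \<in> U i" "f = single i x" by (auto simp: homogeneous_def)
  have "lower f = single (i - 1) (B x - scale (\<theta>' i) x)"
    using x by (auto simp: lower_def single_def fun_eq_iff linD[OF lin_B])
  then show ?thesis using B_shift[of x i i] x by (auto simp: homogeneous_def U_def)
qed

lemma raise_pow_homogeneous: "f \<in> homogeneous i \<Longrightarrow> (raise ^^ k) f \<in> homogeneous (i + int k)"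
proof (induction k)
  case (Suc k)
  show ?case using raise_homogeneous[OF Suc.IH[OF Suc.prems]] by (simp add: algebra_simps)
qed simp

lemma lower_pow_homogeneous: "f \<in> homogeneous i \<Longrightarrow> (lower ^^ k) f \<in> homogeneous (i - int k)"
proof (induction k)
  case (Suc k)
  show ?case using lower_homogeneous[OF Suc.IH[OF Suc.prems]] by (simp add: algebra_simps)
qed simp

lemma alt_word_homogeneous:
  "f \<in> homogeneous i \<Longrightarrow> alt_word raise lower ks f \<in> homogeneous (i + alt_sum ks) \<and>
     alt_word lower raise ks f \<in> homogeneous (i - alt_sum ks)"
proof (induction ks arbitrary: i f)
  case (Cons k ks)
  show ?case
    using Cons.IH[OF raise_pow_homogeneous[OF Cons.prems, of k]] Cons.IH[OF lower_pow_homogeneous[OF Cons.prems, of k]]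
    by (simp add: algebra_simps)
qed simp

lemma homogeneous_outside: "f \<in> homogeneous i \<Longrightarrow> i < 0 \<or> i > int d \<Longrightarrow> f = 0"
  by (auto simp: homogeneous_def U_outside single_def fun_eq_iff)

lemma lower_raise_eq_0: "f \<in> homogeneous 0 \<Longrightarrow> b < a \<Longrightarrow> (lower ^^ a) ((raise ^^ b) f) = 0"
  using lower_pow_homogeneous[OF raise_pow_homogeneous, of f 0 a b]
    homogeneous_outside[of _ "int b - int a"] by simp

text \<open>The families concentrated in degree \<open>0\<close> with value in \<open>U 0\<close> form a copy of \<open>U 0\<close>, on which the operators
  \<open>lower\<^sup>k raise\<^sup>k\<close> commute.\<close>

lemma exists_generator:
  "\<exists>v\<in>U 0. v \<noteq> 0 \<and> (\<forall>k. \<exists>c. (lower ^^ k) ((raise ^^ k) (single 0 v)) = fscale c (single 0 v))"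
proof -
  define C where "C = (\<lambda>k v. (lower ^^ k) ((raise ^^ k) (single 0 v)) 0)"
  have C_app: "C k u = (lower ^^ k) ((raise ^^ k) (single 0 u)) 0" for k u
    by (simp add: C_def)
  have C_hom: "(lower ^^ k) ((raise ^^ k) (single 0 w)) = single 0 (C k w) \<and> C k w \<in> U 0" if "w \<in> U 0" for k w
  proof -
    have "single 0 w \<in> homogeneous 0" using that by (auto simp: homogeneous_def)
    then have "(lower ^^ k) ((raise ^^ k) (single 0 w)) \<in> homogeneous 0"
      using lower_pow_homogeneous[OF raise_pow_homogeneous, of _ 0 k k] by simp
    then show ?thesis unfolding C_def by (rule homogeneousD)
  qed
  have "lin (C k)" for k
  proof (rule linI)
    have L: "fn.lin (\<lambda>f. (lower ^^ k) ((raise ^^ k) f))"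
      by (rule fn.lin_comp[OF fn.lin_funpow[OF lin_lower] fn.lin_funpow[OF lin_raise]])
    have "single 0 (x + y) = single 0 x + single 0 y" for x y by (auto simp: single_def)
    then show "C k (x + y) = C k x + C k y" for x y
      using fn.linD(1)[OF L] by (simp add: C_def)
    have "single 0 (scale c x) = fscale c (single 0 x)" for c x by (auto simp: single_def fscale_def)
    then show "C k (scale c x) = scale c (C k x)" for c x
      using fn.linD(3)[OF L] by (simp add: C_def fscale_def)
  qed
  moreover have "U 0 \<noteq> {0}" using G_nonzero by (simp add: U_def F_UNIV)
  moreover have "C k ` U 0 \<subseteq> U 0" for k using C_hom by auto
  moreover have "C j (C k w) = C k (C j w)" if w: "w \<in> U 0" for j k w
  proof -
    have *: "C j (C k w) = (lower ^^ j) ((raise ^^ j) ((lower ^^ k) ((raise ^^ k) (single 0 w)))) 0" for j k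
      unfolding C_hom[OF w, THEN conjunct1] by (rule C_app)
    have "single 0 w \<in> homogeneous 0" using w by (auto simp: homogeneous_def)
    then show ?thesis unfolding *
      using fn.raise_lower_commute[OF lin_raise lin_lower serre_raise_lower serre_lower_raise lower_raise_eq_0, of "single 0 w" j k]
      by simp
  qed
  ultimately obtain v where v: "v \<in> U 0" "v \<noteq> 0" "\<And>k. \<exists>c. C k v = scale c v"
    using exists_common_eigenvector[of C "U 0"] subspace_U by metis
  have "\<exists>c. (lower ^^ k) ((raise ^^ k) (single 0 v)) = fscale c (single 0 v)" for k
  proof -
    obtain c where "C k v = scale c v" using v(3) by blast
    then have "(lower ^^ k) ((raise ^^ k) (single 0 v)) = fscale c (single 0 v)"
      using C_hom[OF v(1), of k] by (auto simp: single_def fscale_def)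
    then show ?thesis by blast
  qed
  then show ?thesis using v by blast
qed

text \<open>A final exponent \<open>0\<close> can be dropped, and a first exponent above \<open>d\<close> raises beyond the top degree.\<close>

lemma strict_word_reduce:
  assumes f: "f \<in> homogeneous 0" and ks: "sorted_wrt (>) ks"
  shows "alt_word raise lower ks f = 0 \<or>
    (\<exists>ls. sorted_wrt (>) ls \<and> set ls \<subseteq> {1..d} \<and> alt_word raise lower ks f = alt_word raise lower ls f)"
proof -
  define ls where "ls = (if ks \<noteq> [] \<and> last ks = 0 then butlast ks else ks)"
  have word: "alt_word raise lower ks f = alt_word raise lower ls f"
  proof (cases "ks \<noteq> [] \<and> last ks = 0")
    case True
    then have "ks = ls @ [0]" by (metis append_butlast_last_id ls_def)
    then show ?thesis by (auto simp: alt_word_append)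
  qed (auto simp: ls_def)
  have ls: "sorted_wrt (>) ls \<and> 0 \<notin> set ls"
    using ks by (cases ks rule: rev_cases) (auto simp: ls_def sorted_wrt_append)
  show ?thesis
  proof (cases "set ls \<subseteq> {1..d}")
    case True
    then show ?thesis using word ls by blast
  next
    case False
    then obtain x where "x \<in> set ls" "x \<notin> {1..d}" by blast
    then have x: "x \<in> set ls" "x > d" using ls by (cases "x = 0"; auto)+
    then obtain k ms where k: "ls = k # ms" by (cases ls) auto
    have "k > d" using x ls k by auto
    then have "(raise ^^ k) f = 0"
      using raise_pow_homogeneous[OF f, of k] homogeneous_outside by force
    then have "alt_word raise lower ls f = 0"
      using fn.linD(4)[OF fn.lin_alt_word[OF lin_lower lin_raise]] by (simp add: k)
    then show ?thesis using word by simp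
  qed
qed

text \<open>
  The values of the decreasing words span an invariant subspace, hence everything. Modulo
  \<open>F (i + 1)\<close>, an element of \<open>F i\<close> is a combination of the words of degree exactly \<open>i\<close>: the part of
  degree less than \<open>i\<close> lies in \<open>G (i - 1) \<inter> F i\<close>, which is zero.
\<close>

lemma dim_le_binomial:
  assumes E: "subspace E" "E \<subseteq> F (int i)" "E \<inter> F (int i + 1) = {0}"
  shows "dim E \<le> d choose i"
proof -
  obtain v where v: "v \<in> U 0" "v \<noteq> 0"
    and eigen: "\<And>k. \<exists>c. (lower ^^ k) ((raise ^^ k) (single 0 v)) = fscale c (single 0 v)"
    using exists_generator by blast
  define f where "f = single 0 v"
  have f: "f \<in> homogeneous 0" using v by (auto simp: f_def homogeneous_def)
  define D where "D = {ks. sorted_wrt (>) ks \<and> set ks \<subseteq> {1..d}}"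
  define w where "w = (\<lambda>ks. alt_word raise lower ks f (alt_sum ks))"
  have word: "alt_word raise lower ks f = single (alt_sum ks) (w ks) \<and> w ks \<in> U (alt_sum ks)" for ks
    unfolding w_def by (rule homogeneousD) (use alt_word_homogeneous[OF f, of ks] in simp)
  have word_in: "alt_word raise lower ks f \<in> fn.span ((\<lambda>ks. alt_word raise lower ks f) ` D)" for ks
  proof -
    let ?Sp = "fn.span ((\<lambda>ks. alt_word raise lower ks f) ` D)"
    have "lower f = 0" using lower_raise_eq_0[OF f, of 0 1] by simp
    then have "alt_word raise lower ks f \<in> fn.span {alt_word raise lower ks f | ks. sorted_wrt (>) ks}"
      using eigen by (intro fn.alt_word_straighten lin_raise lin_lower serre_raise_lower serre_lower_raise)
        (auto simp: f_def)
    also have "\<dots> \<subseteq> ?Sp"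
    proof (intro fn.span_minimal fn.subspace_span subsetI)
      fix g assume "g \<in> {alt_word raise lower ks f | ks. sorted_wrt (>) ks}"
      then obtain ks where "sorted_wrt (>) ks" "g = alt_word raise lower ks f" by blast
      then show "g \<in> ?Sp"
        using strict_word_reduce[OF f, of ks] fn.span_zero by (auto simp: D_def intro: fn.span_base)
    qed
    finally show ?thesis .
  qed
  have value_in: "g j \<in> span (w ` decreasing_lists d j)"
    if "g \<in> fn.span ((\<lambda>ks. alt_word raise lower ks f) ` D)" for g j
    using that
  proof (induction rule: fn.span_induct)
    case base
    show ?case
      by (auto simp: fn.subspace_def fscale_def intro: span_zero span_add span_scale)
  next
    case (step g)
    then obtain ks where ks: "ks \<in> D" "g = alt_word raise lower ks f" by blast
    show ?case
    proof (cases "j = alt_sum ks")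
      case True
      then have "ks \<in> decreasing_lists d j" using ks by (simp add: D_def decreasing_lists_def)
      then show ?thesis using ks word[of ks] True by (auto simp: single_def intro!: span_base)
    next
      case False
      then show ?thesis using ks word[of ks] by (auto simp: single_def span_zero)
    qed
  qed
  have sub: "decreasing_lists d j \<subseteq> D" for j by (auto simp: D_def decreasing_lists_def)
  \<comment> \<open>The last letter of a word is determined by the parity of its length; an exponent \<open>0\<close> changes it.\<close>
  have raise_w: "raise (alt_word raise lower ks f) j \<in> span (w ` D)" for ks j
  proof -
    have "raise (alt_word raise lower ks f) = alt_word raise lower (ks @ (if even (length ks) then [1] else [0, 1])) f"
      by (simp add: alt_word_append)
    then show ?thesis using value_in[OF word_in] span_mono[OF image_mono[OF sub]] by (metis subsetD)
  qed
  have lower_w: "lower (alt_word raise lower ks f) j \<in> span (w ` D)" for ks j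
  proof -
    have "lower (alt_word raise lower ks f) = alt_word raise lower (ks @ (if even (length ks) then [0, 1] else [1])) f"
      by (simp add: alt_word_append)
    then show ?thesis using value_in[OF word_in] span_mono[OF image_mono[OF sub]] by (metis subsetD)
  qed
  have "span (w ` D) = {0} \<or> span (w ` D) = UNIV"
  proof (rule irreducible)
    have "A (w ks) \<in> span (w ` D)" if "ks \<in> D" for ks
    proof -
      have "A (w ks) = raise (alt_word raise lower ks f) (alt_sum ks + 1) + scale (\<theta> (alt_sum ks)) (w ks)"
        by (simp add: raise_def w_def)
      then show ?thesis
        by (simp only: span_add[OF raise_w span_scale[OF span_base[OF imageI[OF that]]]])
    qed
    then show "A ` span (w ` D) \<subseteq> span (w ` D)" by (intro span_invariant lin_A) auto
    have "B (w ks) \<in> span (w ` D)" if "ks \<in> D" for ks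
    proof -
      have "B (w ks) = lower (alt_word raise lower ks f) (alt_sum ks - 1) + scale (\<theta>' (alt_sum ks)) (w ks)"
        by (simp add: lower_def w_def)
      then show ?thesis
        by (simp only: span_add[OF lower_w span_scale[OF span_base[OF imageI[OF that]]]])
    qed
    then show "B ` span (w ` D) \<subseteq> span (w ` D)" by (intro span_invariant lin_B) auto
  qed simp
  moreover have "v \<in> span (w ` D)"
    by (rule span_base) (force simp: w_def D_def f_def single_def intro!: image_eqI[of _ _ "[]"])
  ultimately have all: "span (w ` D) = UNIV" using v by auto
  define D0 where "D0 = {ks \<in> D. alt_sum ks < int i}"
  define D1 where "D1 = decreasing_lists d (int i)"
  define D2 where "D2 = {ks \<in> D. alt_sum ks > int i}"
  have split: "w ` D = w ` D0 \<union> (w ` D1 \<union> w ` D2)"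
    unfolding image_Un[symmetric] by (rule arg_cong[where f = "(`) w"]) (auto simp: D0_def D1_def D2_def D_def decreasing_lists_def)
  have sp0: "span (w ` D0) \<subseteq> G (int i - 1)"
  proof (intro span_minimal subspace_G image_subsetI)
    fix ks assume "ks \<in> D0"
    then show "w ks \<in> G (int i - 1)"
      using word[of ks] G_mono[of "alt_sum ks" "int i - 1"] by (auto simp: D0_def U_def)
  qed
  have sp1: "span (w ` D1) \<subseteq> F (int i)"
  proof (intro span_minimal subspace_F image_subsetI)
    fix ks assume "ks \<in> D1"
    then show "w ks \<in> F (int i)" using word[of ks] by (auto simp: D1_def decreasing_lists_def U_def)
  qed
  have sp2: "span (w ` D2) \<subseteq> F (int i + 1)"
  proof (intro span_minimal subspace_F image_subsetI)
    fix ks assume "ks \<in> D2"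
    then show "w ks \<in> F (int i + 1)"
      using word[of ks] F_antimono[of "int i + 1" "alt_sum ks"] by (auto simp: D2_def U_def)
  qed
  let ?F = "F (int i + 1)"
  have "{x + y |x y. x \<in> E \<and> y \<in> ?F} \<subseteq> {x + y |x y. x \<in> span (w ` D1) \<and> y \<in> ?F}"
  proof
    fix z assume "z \<in> {x + y |x y. x \<in> E \<and> y \<in> ?F}"
    then obtain x y where xy: "z = x + y" "x \<in> E" "y \<in> ?F" by blast
    have x: "x \<in> F (int i)" using xy E by auto
    have "x \<in> span (w ` D0 \<union> (w ` D1 \<union> w ` D2))" using all split by simp
    then obtain a b c where abc: "x = a + (b + c)" "a \<in> span (w ` D0)" "b \<in> span (w ` D1)" "c \<in> span (w ` D2)"
      unfolding span_Un by blast
    have c: "c \<in> ?F" using abc sp2 by auto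
    have "b + c \<in> F (int i)"
      using abc sp1 c F_antimono[of "int i" "int i + 1"] by (intro subspace_add[OF subspace_F]) auto
    then have "x - (b + c) \<in> F (int i)" using x subspace_diff[OF subspace_F] by blast
    then have "a \<in> G (int i - 1) \<inter> F (int i - 1 + 1)" using abc sp0 by auto
    then have "a = 0" unfolding G_Int_F_eq_0 by simp
    then have "z = b + (c + y)" "c + y \<in> ?F"
      using xy abc c by (auto simp: add.assoc intro: subspace_add[OF subspace_F])
    then show "z \<in> {x + y |x y. x \<in> span (w ` D1) \<and> y \<in> ?F}" using abc by blast
  qed
  then have le: "dim {x + y |x y. x \<in> E \<and> y \<in> ?F} \<le> dim {x + y |x y. x \<in> span (w ` D1) \<and> y \<in> ?F}"
    by (rule dim_subset)
  have "dim {x + y |x y. x \<in> E \<and> y \<in> ?F} = dim E + dim ?F"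
    using dim_sums_Int[OF E(1) subspace_F[of "int i + 1"]] E(3) by simp
  moreover have "dim {x + y |x y. x \<in> span (w ` D1) \<and> y \<in> ?F} \<le> dim (span (w ` D1)) + dim ?F"
    using dim_sums_Int[OF subspace_span subspace_F[of "int i + 1"], of "w ` D1"] by linarith
  ultimately have "dim E \<le> dim (span (w ` D1))" using le by linarith
  also have "\<dots> \<le> card (w ` D1)"
    by (simp add: dim_le_card' D1_def finite_decreasing_lists)
  also have "\<dots> \<le> card D1" by (simp add: card_image_le D1_def finite_decreasing_lists)
  also have "\<dots> \<le> d choose i" unfolding D1_def by (rule card_decreasing_lists)
  finally show ?thesis .
qed

end

section \<open>Eigenspaces along a standard ordering\<close>

locale eigenspace_ordering = q_vector_space scale q
  for scale :: "'a::field \<Rightarrow> 'b::ab_group_add \<Rightarrow> 'b" and q +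
  fixes A B :: "'b \<Rightarrow> 'b" and d :: nat and V :: "nat \<Rightarrow> 'b set" and t :: "nat \<Rightarrow> 'a"
  assumes lin_A: "lin A" and lin_B: "lin B" and diag: "diagonalizable scale A"
    and ordering: "standard_ordering scale A B d V"
    and V_eq: "i \<le> d \<Longrightarrow> V i = {v. A v = scale (t i) v}"
begin

definition part :: "nat set \<Rightarrow> 'b set" where
  "part J = span (\<Union>j\<in>J. V j)"

lemma V_bij: "bij_betw V {0..d} (eigenspaces scale A)"
  using ordering by (simp add: standard_ordering_def)

lemma V_nonzero:
  assumes "i \<le> d"
  shows "V i \<noteq> {0}"
proof -
  have "V i \<in> eigenspaces scale A" by (rule bij_betw_apply[OF V_bij]) (use assms in simp)
  then show ?thesis by (simp add: eigenspaces_def)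
qed

lemma t_inj:
  assumes "i \<le> d" "j \<le> d" "t i = t j"
  shows "i = j"
proof -
  have "V i = V j" using assms by (simp add: V_eq)
  then show ?thesis using inj_onD[OF bij_betw_imp_inj_on[OF V_bij], of i j] assms by simp
qed

lemma subspace_V: "i \<le> d \<Longrightarrow> subspace (V i)"
  unfolding subspace_def by (simp add: V_eq linD[OF lin_A] scale_right_distrib mult.commute)

lemma V_part: "v \<in> V j \<Longrightarrow> j \<in> J \<Longrightarrow> v \<in> part J"
  unfolding part_def by (rule span_base) auto

lemma subspace_part: "subspace (part J)"
  by (simp add: part_def)

lemma part_mono: "J \<subseteq> K \<Longrightarrow> part J \<subseteq> part K"
  unfolding part_def by (rule span_mono) auto

lemma part_induct:
  assumes "lin T" "subspace W" "\<And>j v. j \<in> J \<Longrightarrow> v \<in> V j \<Longrightarrow> T v \<in> W" "x \<in> part J"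
  shows "T x \<in> W"
proof -
  have "subspace {x. T x \<in> W}"
    using linD[OF assms(1)] assms(2) by (auto simp: subspace_def)
  then have "part J \<subseteq> {x. T x \<in> W}"
    unfolding part_def using assms(3) by (intro span_minimal) auto
  then show ?thesis using assms(4) by auto
qed

lemma lin_shift: "lin (\<lambda>v. A v - scale c v)"
  by (rule linI) (simp_all add: linD[OF lin_A] algebra_simps scale_right_diff_distrib)

text \<open>Subtracting \<open>t i\<close> removes the \<open>i\<close>-th eigenspace; the condition on \<open>c\<close> is void if \<open>i\<close> does not occur.\<close>

lemma A_part_remove:
  assumes "J \<subseteq> {..d}" "x \<in> part J" "i \<in> J \<Longrightarrow> c = t i"
  shows "A x - scale c x \<in> part (J - {i})"
proof (rule part_induct[OF lin_shift subspace_part _ assms(2)])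
  fix j v assume j: "j \<in> J" "v \<in> V j"
  then have v: "A v - scale c v = scale (t j - c) v"
    using assms(1) V_eq[of j] by (auto simp: scale_left_diff_distrib)
  show "A v - scale c v \<in> part (J - {i})"
  proof (cases "j = i")
    case True
    then show ?thesis using v assms(3) j subspace_0[OF subspace_part] by simp
  next
    case False
    then show ?thesis unfolding v using j by (intro subspace_scale[OF subspace_part] V_part) auto
  qed
qed

lemma A_part: "J \<subseteq> {..d} \<Longrightarrow> x \<in> part J \<Longrightarrow> A x \<in> part J"
proof (rule part_induct[OF lin_A subspace_part])
  fix j v assume j: "J \<subseteq> {..d}" "j \<in> J" "v \<in> V j"
  then have "A v = scale (t j) v" using V_eq[of j] by auto
  then show "A v \<in> part J" using V_part[OF j(3,2)] subspace_scale[OF subspace_part] by simp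
qed

lemma V_Int_part: "finite J \<Longrightarrow> J \<subseteq> {..d} \<Longrightarrow> i \<le> d \<Longrightarrow> i \<notin> J \<Longrightarrow> V i \<inter> part J = {0}"
proof (induction J rule: finite_induct)
  case empty
  then show ?case using subspace_0[OF subspace_V] by (auto simp: part_def)
next
  case (insert j J)
  have "x = 0" if x: "x \<in> V i" "x \<in> part (insert j J)" for x
  proof -
    have "A x - scale (t j) x \<in> part (insert j J - {j})"
      using insert.prems x by (intro A_part_remove) auto
    moreover have Ax: "A x = scale (t i) x" using x insert.prems V_eq[of i] by auto
    ultimately have "scale (t i - t j) x \<in> part J"
      using insert.hyps by (simp add: scale_left_diff_distrib)
    moreover have "scale (t i - t j) x \<in> V i"
      using x insert.prems by (intro subspace_scale[OF subspace_V]) auto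
    ultimately have "scale (t i - t j) x = 0" using insert.IH insert.prems by blast
    moreover have "t i \<noteq> t j" using t_inj[of i j] insert.prems by auto
    ultimately show ?thesis by simp
  qed
  then show ?case using subspace_0[OF subspace_part] subspace_0[OF subspace_V] insert.prems by auto
qed

lemma part_all: "part {..d} = UNIV"
proof -
  have "\<Union> (eigenspaces scale A) = (\<Union>j\<in>{..d}. V j)"
    using bij_betw_imp_surj_on[OF V_bij] by (simp add: atLeast0AtMost)
  then show ?thesis using diag by (simp add: diagonalizable_def part_def)
qed

lemma zero_extend_part:
  assumes "x \<in> zero_extend d V j" "\<And>k. int k = j \<Longrightarrow> k \<le> d \<Longrightarrow> k \<in> J"
  shows "x \<in> part J"
proof (cases "0 \<le> j \<and> j \<le> int d")
  case True
  then have "x \<in> V (nat j)" "nat j \<in> J" using assms by (auto simp: zero_extend_def)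
  then show ?thesis by (rule V_part)
next
  case False
  then show ?thesis using assms subspace_0[OF subspace_part] by (auto simp: zero_extend_def)
qed

lemma tridiagonal:
  assumes "i \<le> d" "v \<in> V i"
  obtains x y z where "B v = x + y + z" "x \<in> zero_extend d V (int i - 1)"
    "y \<in> V i" "z \<in> zero_extend d V (int i + 1)"
proof -
  have "i \<in> {0..d}" using assms(1) by simp
  then have "B ` V i \<subseteq> {x + y + z | x y z. x \<in> zero_extend d V (int i - 1) \<and> y \<in> zero_extend d V (int i) \<and>
                            z \<in> zero_extend d V (int i + 1)}"
    using ordering unfolding standard_ordering_def by (elim conjE) (rule bspec)
  then have "B v \<in> {x + y + z | x y z. x \<in> zero_extend d V (int i - 1) \<and> y \<in> zero_extend d V (int i) \<and>
                            z \<in> zero_extend d V (int i + 1)}"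
    using assms(2) by (rule subsetD[OF _ imageI])
  moreover have "zero_extend d V (int i) = V i" using assms(1) by (simp add: zero_extend_def)
  ultimately show ?thesis using that by blast
qed

lemma B_part:
  assumes "J \<subseteq> {..d}" "x \<in> part J"
    and K: "\<And>j k. j \<in> J \<Longrightarrow> k \<le> d \<Longrightarrow> \<bar>int k - int j\<bar> \<le> 1 \<Longrightarrow> k \<in> K"
  shows "B x \<in> part K"
proof (rule part_induct[OF lin_B subspace_part _ assms(2)])
  fix j v assume j: "j \<in> J" "v \<in> V j"
  then have jd: "j \<le> d" using assms(1) by auto
  obtain x y z where xyz: "B v = x + y + z" "x \<in> zero_extend d V (int j - 1)"
    "y \<in> V j" "z \<in> zero_extend d V (int j + 1)"
    using tridiagonal[OF jd j(2)] .
  have "x \<in> part K" by (rule zero_extend_part[OF xyz(2)]) (use K[OF j(1)] in auto)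
  moreover have "y \<in> part K" using xyz(3) by (rule V_part) (use K[OF j(1) jd] in auto)
  moreover have "z \<in> part K" by (rule zero_extend_part[OF xyz(4)]) (use K[OF j(1)] in auto)
  ultimately show "B v \<in> part K" unfolding xyz(1) by (intro subspace_add[OF subspace_part])
qed

text \<open>
  On \<open>B v\<close> with \<open>v \<in> V i\<close> the Serre relation becomes the cubic \<open>s\<close> in \<open>A\<close>, whose roots are \<open>t i\<close>,
  \<open>Q * t i\<close> and \<open>t i / Q\<close>. If \<open>t (Suc i)\<close> were none of these, the component of \<open>B v\<close> in \<open>V (Suc i)\<close> would
  vanish, and \<open>V 0 + \<dots> + V i\<close> would be a proper invariant subspace.
\<close>

lemma eigenvalue_step:
  assumes serre: "q_serre scale q A B"
    and irreducible: "\<And>W. subspace W \<Longrightarrow> A ` W \<subseteq> W \<Longrightarrow> B ` W \<subseteq> W \<Longrightarrow> W = {0} \<or> W = UNIV"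
    and i: "i < d"
  shows "t (Suc i) = q ^ 2 * t i \<or> t i = q ^ 2 * t (Suc i)"
proof (rule ccontr)
  assume neg: "\<not> ?thesis"
  define Q where "Q = q ^ 2"
  define e where "e = q_bracket q 3"
  have Q: "Q \<noteq> 0" using q_nonzero by (simp add: Q_def)
  have e: "e = Q + 1 + inverse Q"
    using q_bracket_3 by (simp add: e_def Q_def)
  define M where "M = (\<lambda>u. A (A (A u)) - scale (e * t i) (A (A u)) + scale (e * t i ^ 2) (A u) - scale (t i ^ 3) u)"
  define s where "s = (\<lambda>m. m ^ 3 - e * t i * m ^ 2 + e * t i ^ 2 * m - t i ^ 3)"
  have lin_M: "lin M"
    unfolding M_def by (rule linI) (simp_all add: linD[OF lin_A] algebra_simps scale_right_diff_distrib scale_right_distrib)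
  have M_eig: "M u = scale (s m) u" if "A u = scale m u" for u m
    using that by (simp add: M_def s_def linD[OF lin_A] scale_left_diff_distrib scale_left_distrib
        power2_eq_square power3_eq_cube mult_ac)
  have s_fact: "s m = (m - t i) * (m - Q * t i) * (m - inverse Q * t i)" for m
    using Q unfolding s_def e by (simp add: power2_eq_square power3_eq_cube field_simps)
  have s_ne: "s (t (Suc i)) \<noteq> 0"
  proof -
    have "t (Suc i) \<noteq> t i" using t_inj[of "Suc i" i] i by auto
    moreover have "t (Suc i) \<noteq> Q * t i" using neg by (simp add: Q_def)
    moreover have "t (Suc i) \<noteq> inverse Q * t i" using neg Q by (auto simp: Q_def)
    ultimately show ?thesis by (simp add: s_fact)
  qed
  have BV: "B v \<in> part {..i}" if v: "v \<in> V i" for v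
  proof -
    obtain x y z where xyz: "B v = x + y + z" "x \<in> zero_extend d V (int i - 1)"
      "y \<in> V i" "z \<in> zero_extend d V (int i + 1)"
      using tridiagonal[of i v] v i by auto
    have Av: "A v = scale (t i) v" using v V_eq[of i] i by auto
    have "M (B v) = 0"
    proof -
      have "(A ^^ 3) (B v) - scale e ((A ^^ 2) (B (A v))) + scale e (A (B ((A ^^ 2) v))) - B ((A ^^ 3) v) = 0"
        using serre unfolding q_serre_def e_def by blast
      then show ?thesis
        by (simp add: funpow_numeral Av linD[OF lin_A] linD[OF lin_B] M_def power2_eq_square power3_eq_cube mult_ac)
    qed
    moreover have "M y = 0" using M_eig[of y "t i"] xyz(3) V_eq[of i] i by (auto simp: s_fact)
    moreover have "int i + 1 = int (Suc i)" by simp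
    then have z: "z \<in> V (Suc i)" using xyz(4) i by (simp add: zero_extend_def nat_add_distrib)
    then have "M z = scale (s (t (Suc i))) z" using M_eig V_eq[of "Suc i"] i by auto
    ultimately have Mx: "M x = - scale (s (t (Suc i))) z"
      unfolding xyz(1) by (simp add: linD[OF lin_M] add_eq_0_iff2)
    have x: "x \<in> part ({..<i})" by (rule zero_extend_part[OF xyz(2)]) auto
    have sub: "{..<i} \<subseteq> {..d}" using i by auto
    have "M x \<in> part {..<i}"
      unfolding M_def using x
      by (intro subspace_diff[OF subspace_part] subspace_add[OF subspace_part] subspace_scale[OF subspace_part] A_part[OF sub])
    then have "scale (s (t (Suc i))) z \<in> part {..<i}"
      using subspace_neg[OF subspace_part] Mx by fastforce
    moreover have "scale (s (t (Suc i))) z \<in> V (Suc i)"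
      using z i by (intro subspace_scale[OF subspace_V]) auto
    moreover have "V (Suc i) \<inter> part {..<i} = {0}"
      by (rule V_Int_part[OF _ sub]) (use i in auto)
    ultimately have "scale (s (t (Suc i))) z = 0" by blast
    then have "z = 0" using s_ne by simp
    moreover have "x \<in> part {..i}" by (rule subsetD[OF part_mono x]) auto
    moreover have "y \<in> part {..i}" using xyz(3) by (rule V_part) simp
    ultimately show ?thesis unfolding xyz(1) by (simp add: subspace_add[OF subspace_part])
  qed
  have trivial: "part {..i} = {0} \<or> part {..i} = UNIV"
  proof (rule irreducible[OF subspace_part])
    show "A ` part {..i} \<subseteq> part {..i}" using A_part[of "{..i}"] i by auto
    show "B ` part {..i} \<subseteq> part {..i}"
    proof
      fix w assume "w \<in> B ` part {..i}"
      then obtain x where x: "x \<in> part {..i}" "w = B x" by auto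
      have "B x \<in> part {..i}"
      proof (rule part_induct[OF lin_B subspace_part _ x(1)])
        fix j v assume j: "j \<in> {..i}" "v \<in> V j"
        show "B v \<in> part {..i}"
        proof (cases "j = i")
          case True
          then show ?thesis using BV j by simp
        next
          case False
          have "v \<in> part {j}" using j(2) by (rule V_part) simp
          then show ?thesis using False j i by (intro B_part[of "{j}"]) auto
        qed
      qed
      then show "w \<in> part {..i}" using x by simp
    qed
  qed
  have "V 0 \<subseteq> part {..i}" using V_part[of _ 0 "{..i}"] by auto
  moreover have "V 0 \<noteq> {0}" "0 \<in> V 0" using V_nonzero subspace_0[OF subspace_V] by auto
  ultimately have "part {..i} \<noteq> {0}" by auto
  moreover have "part {..i} \<noteq> UNIV"
  proof
    assume "part {..i} = UNIV"
    moreover have "V (Suc i) \<inter> part {..i} = {0}" by (rule V_Int_part) (use i in auto)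
    ultimately show False using V_nonzero[of "Suc i"] i by simp
  qed
  ultimately show False using trivial by blast
qed

text \<open>The ratio cannot switch between \<open>Q\<close> and \<open>1 / Q\<close>, as then \<open>t (i + 2) = t i\<close>.\<close>

lemma eigenvalues_geometric:
  assumes serre: "q_serre scale q A B"
    and irreducible: "\<And>W. subspace W \<Longrightarrow> A ` W \<subseteq> W \<Longrightarrow> B ` W \<subseteq> W \<Longrightarrow> W = {0} \<or> W = UNIV"
  shows "(\<forall>i\<le>d. t i = t 0 * (q ^ 2) ^ i) \<or> (\<forall>i\<le>d. t i = t 0 * (inverse q ^ 2) ^ i)"
proof -
  have Q: "q ^ 2 \<noteq> 0" using q_nonzero by simp
  have step: "t (Suc i) = q ^ 2 * t i \<or> t (Suc i) = inverse q ^ 2 * t i" if "i < d" for i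
    using eigenvalue_step[OF serre irreducible that] Q by (auto simp: power_inverse)
  have main: "t (Suc i) = P * t i" if P: "P * P' = 1" "d > 0 \<Longrightarrow> t 1 = P * t 0"
    "\<And>i. i < d \<Longrightarrow> t (Suc i) = P * t i \<or> t (Suc i) = P' * t i" and "i < d" for P P' i
    using \<open>i < d\<close>
  proof (induction i)
    case 0
    then show ?case using P by simp
  next
    case (Suc i)
    have "t (Suc (Suc i)) \<noteq> t i" using t_inj[of "Suc (Suc i)" i] Suc.prems by auto
    moreover have "P' * t (Suc i) = t i" using Suc P(1) by (simp add: mult.assoc[symmetric] mult.commute[of P'])
    ultimately show ?case using P(3)[of "Suc i"] Suc.prems by auto
  qed
  have geo: "\<forall>i\<le>d. t i = t 0 * P ^ i" if "\<And>i. i < d \<Longrightarrow> t (Suc i) = P * t i" for P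
  proof (intro allI impI)
    fix i assume "i \<le> d"
    then show "t i = t 0 * P ^ i" by (induction i) (auto simp: that)
  qed
  have inv: "q ^ 2 * inverse q ^ 2 = 1" "inverse q ^ 2 * q ^ 2 = 1"
    using q_nonzero by (simp_all add: power_inverse)
  consider "d = 0" | "d > 0" "t 1 = q ^ 2 * t 0" | "d > 0" "t 1 = inverse q ^ 2 * t 0"
    using step[of 0] by auto
  then show ?thesis
  proof cases
    case 1
    then show ?thesis by simp
  next
    case 2
    then show ?thesis using geo[of "q ^ 2"] main[OF inv(1)] step by blast
  next
    case 3
    then show ?thesis using geo[of "inverse q ^ 2"] main[OF inv(2)] step by blast
  qed
qed

end

section \<open>The bound on the shape vector\<close>

lemma (in q_vector_space) eigenspace_orderingI:
  assumes "lin A" "lin B" "diagonalizable scale A" "standard_ordering scale A B d V"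
    and "\<And>i. i \<le> d \<Longrightarrow> V i = {v. A v = scale (t i) v}"
  shows "eigenspace_ordering scale q A B d V t"
  using assms q_vector_space_axioms
  by (simp add: eigenspace_ordering_def eigenspace_ordering_axioms_def)

context q_vector_space_fd begin

text \<open>The case in which the two eigenvalue sequences run in the opposite directions required by the
  locale \<open>split_pair\<close>.\<close>

lemma dim_eigenspace_le:
  assumes EA: "eigenspace_ordering scale q A B d V t" and EB: "eigenspace_ordering scale q B A e V' t'"
    and serre: "q_serre scale q A B" "q_serre scale q B A"
    and irreducible: "\<And>W. subspace W \<Longrightarrow> A ` W \<subseteq> W \<Longrightarrow> B ` W \<subseteq> W \<Longrightarrow> W = {0} \<or> W = UNIV"
    and t: "\<And>i. i \<le> d \<Longrightarrow> t i = \<alpha> * (q ^ 2) ^ i" and t': "\<And>i. i \<le> e \<Longrightarrow> t' i = \<beta> * (inverse q ^ 2) ^ i"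
    and i: "i \<le> d"
  shows "dim (V i) \<le> d choose i"
proof -
  interpret EA: eigenspace_ordering scale q A B d V t by (rule EA)
  interpret EB: eigenspace_ordering scale q B A e V' t' by (rule EB)
  define \<theta> where "\<theta> = (\<lambda>j. \<alpha> * (q ^ 2) powi j)"
  define \<theta>' where "\<theta>' = (\<lambda>j. \<beta> * (inverse q ^ 2) powi j)"
  define J where "J = (\<lambda>i. {j. j \<le> d \<and> i \<le> int j})"
  define K where "K = (\<lambda>i. {j. j \<le> e \<and> int j \<le> i})"
  have J: "J i \<subseteq> {..d}" "finite (J i)" for i
    using finite_subset[of "J i" "{..d}"] by (auto simp: J_def)
  have K: "K i \<subseteq> {..e}" for i by (auto simp: K_def)
  define F where "F = (\<lambda>i. EA.part (J i))"
  define G where "G = (\<lambda>i. EB.part (K i))"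
  have F_UNIV: "F i = UNIV" if "i \<le> 0" for i
  proof -
    have "J i = {..d}" using that by (auto simp: J_def)
    then show ?thesis by (simp add: F_def EA.part_all)
  qed
  have G_0: "G i = {0}" if "i < 0" for i
  proof -
    have "K i = {}" using that by (auto simp: K_def)
    then show ?thesis by (simp add: G_def EB.part_def)
  qed
  interpret S: split_pair scale q Basis A B \<theta> \<theta>' F G d
  proof
    show "A (x + y) = A x + A y" "A (scale c x) = scale c (A x)"
      "B (x + y) = B x + B y" "B (scale c x) = scale c (B x)" for x y c
      by (simp_all add: linD[OF EA.lin_A] linD[OF EA.lin_B])
    show "q_serre scale q A B" "q_serre scale q B A" using serre .
    show "\<theta> (j + 1) = q ^ 2 * \<theta> j" for j
      using q_nonzero by (simp add: \<theta>_def power_int_add_1)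
    show "\<theta>' j = q ^ 2 * \<theta>' (j + 1)" for j
      using q_nonzero by (simp add: \<theta>'_def power_int_add_1 power_inverse)
    show "subspace (F i)" "subspace (G i)" for i
      by (simp_all add: F_def G_def EA.subspace_part EB.subspace_part)
    show "F j \<subseteq> F i" if "i \<le> j" for i j
      unfolding F_def by (rule EA.part_mono) (use that in \<open>auto simp: J_def\<close>)
    show "G i \<subseteq> G j" if "i \<le> j" for i j
      unfolding G_def by (rule EB.part_mono) (use that in \<open>auto simp: K_def\<close>)
    show "F i = UNIV" if "i \<le> 0" for i using F_UNIV that .
    show "F i = {0}" if "i > int d" for i
    proof -
      have "J i = {}" using that by (auto simp: J_def)
      then show ?thesis by (simp add: F_def EA.part_def)
    qed
    show "G i = {0}" if "i < 0" for i using G_0 that .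
    show "A x - scale (\<theta> i) x \<in> F (i + 1)" if x: "x \<in> F i" for x i
    proof (cases "i < 0")
      case True
      then show ?thesis by (simp add: F_UNIV)
    next
      case False
      have "A x - scale (\<theta> i) x \<in> EA.part (J i - {nat i})"
        using x J t False by (intro EA.A_part_remove) (auto simp: F_def J_def \<theta>_def power_int_def)
      moreover have "J i - {nat i} \<subseteq> J (i + 1)" using False by (auto simp: J_def)
      ultimately show ?thesis unfolding F_def using EA.part_mono by blast
    qed
    show "B x \<in> F (i - 1)" if "x \<in> F i" for x i
      using that unfolding F_def by (rule EA.B_part[OF J(1)]) (auto simp: J_def)
    show "B x - scale (\<theta>' i) x \<in> G (i - 1)" if x: "x \<in> G i" for x i
    proof (cases "i < 0")
      case True
      then have "x = 0" using x G_0 by auto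
      then show ?thesis using linD(4)[OF EA.lin_B] subspace_0[OF EB.subspace_part] by (simp add: G_def)
    next
      case False
      have "B x - scale (\<theta>' i) x \<in> EB.part (K i - {nat i})"
        using x K t' False by (intro EB.A_part_remove) (auto simp: G_def K_def \<theta>'_def power_int_def)
      moreover have "K i - {nat i} \<subseteq> K (i - 1)" using False by (auto simp: K_def)
      ultimately show ?thesis unfolding G_def using EB.part_mono by blast
    qed
    show "A x \<in> G (i + 1)" if "x \<in> G i" for x i
      using that unfolding G_def by (rule EB.B_part[OF K]) (auto simp: K_def)
    show "F 1 \<noteq> UNIV"
    proof
      assume "F 1 = UNIV"
      moreover have "V 0 \<inter> F 1 = {0}"
        unfolding F_def by (rule EA.V_Int_part[OF J(2,1)]) (auto simp: J_def)
      ultimately show False using EA.V_nonzero[of 0] by simp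
    qed
    have "V' 0 \<subseteq> G 0" using EB.V_part[of _ 0] by (auto simp: G_def K_def)
    moreover have "0 \<in> V' 0" "V' 0 \<noteq> {0}" using EB.V_nonzero[of 0] subspace_0[OF EB.subspace_V[of 0]] by simp_all
    ultimately show "G 0 \<noteq> {0}" by blast
    show "W = {0} \<or> W = UNIV" if "subspace W" "A ` W \<subseteq> W" "B ` W \<subseteq> W" for W
      using irreducible that .
  qed
  show ?thesis
  proof (rule S.dim_le_binomial)
    show "subspace (V i)" using EA.subspace_V i .
    show "V i \<subseteq> F (int i)" using EA.V_part[of _ i] i by (auto simp: F_def J_def)
    show "V i \<inter> F (int i + 1) = {0}"
      unfolding F_def by (rule EA.V_Int_part[OF J(2,1) i]) (auto simp: J_def)
  qed
qed

end

lemma standard_ordering_reverse: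
  assumes "standard_ordering scale A B d V"
  shows "standard_ordering scale A B d (\<lambda>i. V (d - i))"
proof -
  have "bij_betw (\<lambda>i. d - i) {0..d} {0..d}"
    by (rule bij_betw_byWitness[of _ "\<lambda>i. d - i"]) auto
  then have "bij_betw (V \<circ> (\<lambda>i. d - i)) {0..d} (eigenspaces scale A)"
    using assms unfolding standard_ordering_def by (intro bij_betw_trans) auto
  moreover have rev: "zero_extend d (\<lambda>i. V (d - i)) j = zero_extend d V (int d - j)" for j
    by (auto simp: zero_extend_def nat_diff_distrib)
  have "B ` V (d - i) \<subseteq> {x + y + z | x y z. x \<in> zero_extend d (\<lambda>i. V (d - i)) (int i - 1) \<and>
      y \<in> zero_extend d (\<lambda>i. V (d - i)) (int i) \<and> z \<in> zero_extend d (\<lambda>i. V (d - i)) (int i + 1)}"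
    if i: "i \<in> {0..d}" for i
  proof
    fix w assume "w \<in> B ` V (d - i)"
    moreover have "d - i \<in> {0..d}" by simp
    ultimately have "w \<in> {x + y + z | x y z. x \<in> zero_extend d V (int (d - i) - 1) \<and>
      y \<in> zero_extend d V (int (d - i)) \<and> z \<in> zero_extend d V (int (d - i) + 1)}"
      using assms unfolding standard_ordering_def by blast
    then obtain x y z where xyz: "w = x + y + z" "x \<in> zero_extend d V (int (d - i) - 1)"
      "y \<in> zero_extend d V (int (d - i))" "z \<in> zero_extend d V (int (d - i) + 1)"
      by blast
    have ind: "int (d - i) - 1 = int d - (int i + 1)" "int (d - i) + 1 = int d - (int i - 1)"
      "int (d - i) = int d - int i" using i by auto
    note xyz' = xyz(2)[unfolded ind(1)] xyz(3)[unfolded ind(3)] xyz(4)[unfolded ind(2)]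
    have "w = z + y + x" using xyz(1) by (simp add: ac_simps)
    then show "w \<in> {x + y + z | x y z. x \<in> zero_extend d (\<lambda>i. V (d - i)) (int i - 1) \<and>
      y \<in> zero_extend d (\<lambda>i. V (d - i)) (int i) \<and> z \<in> zero_extend d (\<lambda>i. V (d - i)) (int i + 1)}"
      unfolding rev using xyz' by blast
  qed
  ultimately show ?thesis by (simp add: standard_ordering_def o_def)
qed

lemma q_bracket_inverse: "q_bracket (inverse q) n = q_bracket (q :: 'a::field) n"
proof -
  have "(inverse q ^ n - q ^ n) / (inverse q - q) = (- (q ^ n - inverse q ^ n)) / (- (q - inverse q))"
    by simp
  then show ?thesis unfolding q_bracket_def by (simp only: inverse_inverse_eq minus_divide_divide)
qed

lemma q_serre_inverse: "q_serre scale (inverse q) A B \<longleftrightarrow> q_serre scale q A B"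
  by (simp add: q_serre_def q_bracket_inverse)

context q_vector_space_fd begin

text \<open>The parameter \<open>p\<close> is \<open>q\<close> or its inverse, chosen so that the eigenvalues of \<open>A\<close> have ratio \<open>p\<^sup>2\<close>. If
  those of \<open>B\<close> have the same ratio, the ordering of the eigenspaces of \<open>B\<close> is reversed.\<close>

lemma tridiagonal_pair_dim_le:
  assumes pair: "tridiagonal_pair scale A B"
    and serre: "q_serre scale q A B" "q_serre scale q B A"
    and ord: "standard_ordering scale A B d V" and i: "i \<le> d"
  shows "dim (V i) \<le> d choose i"
proof -
  have lin: "lin A" "lin B" and diag: "diagonalizable scale A" "diagonalizable scale B"
    using pair by (auto simp: tridiagonal_pair_def)
  have irr: "W = {0} \<or> W = UNIV" if "subspace W" "A ` W \<subseteq> W" "B ` W \<subseteq> W" for W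
    using pair that unfolding tridiagonal_pair_def by blast
  have irr': "W = {0} \<or> W = UNIV" if "subspace W" "B ` W \<subseteq> W" "A ` W \<subseteq> W" for W
    using irr that by blast
  obtain e V' where ord': "standard_ordering scale B A e V'"
    using pair by (auto simp: tridiagonal_pair_def)
  have eig: "\<exists>t. \<forall>i\<le>d. V i = {v. A v = scale (t i) v}" if "standard_ordering scale A B d V" for A B d V
  proof -
    have "\<exists>c. V i = {v. A v = scale c v}" if "i \<le> d" for i
    proof -
      have "V i \<in> eigenspaces scale A"
        using \<open>standard_ordering scale A B d V\<close> that by (auto simp: standard_ordering_def bij_betw_def)
      then show ?thesis by (auto simp: eigenspaces_def)
    qed
    then show ?thesis by metis
  qed
  obtain t where t: "\<And>i. i \<le> d \<Longrightarrow> V i = {v. A v = scale (t i) v}" using eig[OF ord] by blast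
  obtain t' where t': "\<And>i. i \<le> e \<Longrightarrow> V' i = {v. B v = scale (t' i) v}" using eig[OF ord'] by blast
  have EA: "eigenspace_ordering scale q A B d V t"
    by (rule eigenspace_orderingI[OF lin diag(1) ord t])
  have EB: "eigenspace_ordering scale q B A e V' t'"
    by (rule eigenspace_orderingI[OF lin(2,1) diag(2) ord' t'])
  have "\<exists>p\<in>{q, inverse q}. \<forall>i\<le>d. t i = t 0 * (p ^ 2) ^ i"
    using eigenspace_ordering.eigenvalues_geometric[OF EA serre(1) irr] by blast
  then obtain p where p: "p \<in> {q, inverse q}" "\<And>i. i \<le> d \<Longrightarrow> t i = t 0 * (p ^ 2) ^ i" by blast
  interpret P: q_vector_space_fd scale p Basis
    using p(1) q_nonzero q_not_root_of_unity by unfold_locales (auto simp: power_inverse)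
  have serre_p: "q_serre scale p A B" "q_serre scale p B A"
    using p(1) serre q_serre_inverse by auto
  have EA_p: "eigenspace_ordering scale p A B d V t"
    by (rule P.eigenspace_orderingI[OF lin diag(1) ord t])
  have "(\<forall>i\<le>e. t' i = t' 0 * (q ^ 2) ^ i) \<or> (\<forall>i\<le>e. t' i = t' 0 * (inverse q ^ 2) ^ i)"
    by (rule eigenspace_ordering.eigenvalues_geometric[OF EB serre(2) irr'])
  moreover have "p = q \<and> inverse p = inverse q \<or> p = inverse q \<and> inverse p = q"
    using p(1) by auto
  ultimately have "(\<forall>i\<le>e. t' i = t' 0 * (p ^ 2) ^ i) \<or> (\<forall>i\<le>e. t' i = t' 0 * (inverse p ^ 2) ^ i)"
    by metis
  then show ?thesis
  proof
    assume geo: "\<forall>i\<le>e. t' i = t' 0 * (inverse p ^ 2) ^ i"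
    have "eigenspace_ordering scale p B A e V' t'"
      by (rule P.eigenspace_orderingI[OF lin(2,1) diag(2) ord' t'])
    then show ?thesis
      by (rule P.dim_eigenspace_le[OF EA_p _ serre_p irr p(2) geo[rule_format] i])
  next
    assume geo: "\<forall>i\<le>e. t' i = t' 0 * (p ^ 2) ^ i"
    have EB_rev: "eigenspace_ordering scale p B A e (\<lambda>i. V' (e - i)) (\<lambda>i. t' (e - i))"
      by (rule P.eigenspace_orderingI[OF lin(2,1) diag(2) standard_ordering_reverse[OF ord']])
        (simp add: t')
    have geo': "t' (e - i) = t' 0 * (p ^ 2) ^ e * (inverse p ^ 2) ^ i" if "i \<le> e" for i
    proof -
      have "(p ^ 2) ^ e = (p ^ 2) ^ (e - i) * (p ^ 2) ^ i" using that by (simp flip: power_add)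
      then have eq: "t' 0 * (p ^ 2) ^ e * (inverse p ^ 2) ^ i = t' 0 * (p ^ 2) ^ (e - i)"
        using P.q_nonzero by (simp add: field_simps)
      show ?thesis unfolding eq by (rule geo[rule_format]) simp
    qed
    show ?thesis
      by (rule P.dim_eigenspace_le[OF EA_p EB_rev serre_p irr p(2) geo' i])
  qed
qed

end

theorem theorem1p6:
  fixes scale :: "'k::{alg_closed_field, field_char_0} \<Rightarrow> 'v::ab_group_add \<Rightarrow> 'v"
    and Basis :: "'v set"
    and q :: 'k
    and A A' :: "'v \<Rightarrow> 'v"
    and d :: nat
    and \<rho> :: "nat \<Rightarrow> nat"
  assumes "finite_dimensional_vector_space scale Basis"
    and "vector_space.dim scale (UNIV :: 'v set) > 0"
    and "q \<noteq> 0"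
    and "\<forall>n>0. q ^ n \<noteq> 1"
    and "tridiagonal_pair scale A A'"
    and "q_serre scale q A A'"
    and "q_serre scale q A' A"
    and "diameter_and_shape scale A A' d \<rho>"
  shows "\<forall>i\<in>{0..d}. \<rho> i \<le> d choose i"
proof -
  interpret finite_dimensional_vector_space scale Basis by fact
  interpret q_vector_space_fd scale q Basis
    by unfold_locales (use assms in auto)
  have swap: "tridiagonal_pair scale A' A"
    using assms(5) unfolding tridiagonal_pair_def by blast
  obtain V where V: "standard_ordering scale A A' d V \<or> standard_ordering scale A' A d V"
    and \<rho>: "\<forall>i\<in>{0..d}. \<rho> i = dim (V i)"
    using assms(8) unfolding diameter_and_shape_def by blast
  have "dim (V i) \<le> d choose i" if "i \<le> d" for i
    using V
  proof
    assume "standard_ordering scale A A' d V"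
    then show ?thesis using that by (rule tridiagonal_pair_dim_le[OF assms(5-7)])
  next
    assume "standard_ordering scale A' A d V"
    then show ?thesis using that by (rule tridiagonal_pair_dim_le[OF swap assms(7,6)])
  qed
  then show ?thesis using \<rho> by simp
qed

end
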